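(* Suppose $\alpha>-1$ and $0<p<\alpha+2$. Then the symmetric lifting operator $L$ maps $A^p_\alpha(\mathbb{D})$ boundedly into $A^p_\alpha(\mathbb{D}^2)$. Moreover, this is no longer true when $p>\alpha+2$; that is, if $\alpha>-1$ and $p>\alpha+2$, then $L$ does not map $A^p_\alpha(\mathbb{D})$ boundedly into $A^p_\alpha(\mathbb{D}^2)$.
   Context: $\mathbb{D}$ is the open unit disk in $\mathbb{C}$, $\mathbb{D}^2=\mathbb{D}\times\mathbb{D}$ is the bidisk in $\mathbb{C}^2$, and $H(\mathbb{D})$, $H(\mathbb{D}^2)$ are the spaces of all holomorphic functions on $\mathbb{D}$ and $\mathbb{D}^2$. $dA$ is the normalized area measure on $\mathbb{D}$ (so $A(\mathbb{D})=1$), and for $\alpha>-1$, $dA_\alpha(z)=(\alpha+1)(1-|z|^2)^\alpha\,dA(z)$. For $p>0$ and $\alpha>-1$, $A^p_\alpha(\mathbb{D})$ is the space of $f\in H(\mathbb{D})$ with $\int_{\mathbb{D}}|f(z)|^p\,dA_\alpha(z)<\infty$, and $A^p_\alpha(\mathbb{D}^2)$ is the space of $f\in H(\mathbb{D}^2)$ with $\int_{\mathbb{D}}\int_{\mathbb{D}}|f(z,w)|^p\,dA_\alpha(z)\,dA_\alpha(w)<\infty$. The symmetric lifting operator $L:H(\mathbb{D})\to H(\mathbb{D}^2)$ is defined by $L(f)(z,w)=\frac{f(z)-f(w)}{z-w}$ for $z\neq w$, extended holomorphically to the diagonal (so $L(f)(z,z)=f'(z)$). That $L$ maps $A^p_\alpha(\mathbb{D})$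 boundedly into $A^p_\alpha(\mathbb{D}^2)$ means that there is a constant $C>0$ such that $\int_{\mathbb{D}}\int_{\mathbb{D}}|L(f)(z,w)|^p\,dA_\alpha(z)\,dA_\alpha(w)\le C\int_{\mathbb{D}}|f(z)|^p\,dA_\alpha(z)$ for all $f\in A^p_\alpha(\mathbb{D})$. *)

theory Defs
  imports "HOL-Complex_Analysis.Complex_Analysis"
begin

abbreviation unit_disk :: "complex set" where
  "unit_disk \<equiv> ball 0 1"

abbreviation bidisk :: "(complex \<times> complex) set" where
  "bidisk \<equiv> unit_disk \<times> unit_disk"

text \<open>The real derivative exists and is complex linear at every point.\<close>

definition holomorphic2_on :: "(complex \<times> complex \<Rightarrow> complex) \<Rightarrow> (complex \<times> complex) set \<Rightarrow> bool" where
  "holomorphic2_on F S \<longleftrightarrow>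
     (\<forall>x\<in>S. \<exists>a b. (F has_derivative (\<lambda>(h, k). a * h + b * k)) (at x within S))"

definition disk_area :: "complex measure" where
  "disk_area = uniform_measure lborel unit_disk"

definition weighted_area :: "real \<Rightarrow> complex measure" where
  "weighted_area \<alpha> =
     density disk_area (\<lambda>z. ennreal ((\<alpha> + 1) * (1 - (cmod z)\<^sup>2) powr \<alpha>))"

definition bergman_integral :: "real \<Rightarrow> real \<Rightarrow> (complex \<Rightarrow> complex) \<Rightarrow> ennreal" where
  "bergman_integral \<alpha> p f =
     (\<integral>\<^sup>+z\<in>unit_disk. ennreal (cmod (f z) powr p) \<partial>weighted_area \<alpha>)"

definition bergman_integral2 :: "real \<Rightarrow> real \<Rightarrow> (complex \<times> complex \<Rightarrow> complex) \<Rightarrow> ennreal" where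
  "bergman_integral2 \<alpha> p F =
     (\<integral>\<^sup>+w\<in>unit_disk. (\<integral>\<^sup>+z\<in>unit_disk. ennreal (cmod (F (z, w)) powr p) \<partial>weighted_area \<alpha>)
        \<partial>weighted_area \<alpha>)"

text \<open>Functions are total on the ambient type; their values off the domain play no role.\<close>

definition bergman_space :: "real \<Rightarrow> real \<Rightarrow> (complex \<Rightarrow> complex) set" where
  "bergman_space \<alpha> p = {f. f holomorphic_on unit_disk \<and> bergman_integral \<alpha> p f < \<infinity>}"

definition bergman_space2 :: "real \<Rightarrow> real \<Rightarrow> (complex \<times> complex \<Rightarrow> complex) set" where
  "bergman_space2 \<alpha> p = {F. holomorphic2_on F bidisk \<and> bergman_integral2 \<alpha> p F < \<infinity>}"

definition sym_lift :: "(complex \<Rightarrow> complex) \<Rightarrow> complex \<times> complex \<Rightarrow> complex" where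
  "sym_lift f = (\<lambda>(z, w). if z = w then deriv f z else (f z - f w) / (z - w))"

text \<open>Only the integral inequality is demanded; that the lift of a function in the Bergman space of the
  disk then lies in the Bergman space of the bidisk follows, see \<open>sym_lift_in_bergman_space2\<close>.\<close>

definition sym_lift_maps_boundedly :: "real \<Rightarrow> real \<Rightarrow> bool" where
  "sym_lift_maps_boundedly \<alpha> p \<longleftrightarrow>
     (\<exists>C::real. C > 0 \<and> (\<forall>f\<in>bergman_space \<alpha> p.
        bergman_integral2 \<alpha> p (sym_lift f) \<le> ennreal C * bergman_integral \<alpha> p f))"

lemma sym_lift_has_derivative_diagonal:
  assumes f: "f holomorphic_on S" and S: "open S" and c: "c \<in> S"
  defines "b \<equiv> deriv (deriv f) c / 2"
  shows "(sym_lift f has_derivative (\<lambda>(h, k). b * h + b * k)) (at (c, c))"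
  unfolding has_derivative_at_alt
proof (intro conjI allI impI)
  show "bounded_linear (\<lambda>(h, k). b * h + b * k)"
    unfolding split_def
    by (intro bounded_linear_add bounded_linear_const_mult bounded_linear_fst bounded_linear_snd)
next
  fix e :: real assume e: "e > 0"
  have f': "(deriv f has_field_derivative 2 * b) (at c)"
    using holomorphic_derivI[OF holomorphic_deriv[OF f S] S c] by (simp add: b_def)
  then obtain d1 where d1: "d1 > 0"
    "\<And>y. norm (y - c) < d1 \<Longrightarrow> norm (deriv f y - deriv f c - 2 * b * (y - c)) \<le> e * norm (y - c)"
    using e unfolding has_field_derivative_def has_derivative_at_alt by blast
  obtain d2 where d2: "d2 > 0" "ball c d2 \<subseteq> S"
    using S c by (auto simp: open_contains_ball)
  define d where "d = min d1 d2"
  have "norm (sym_lift f y - sym_lift f (c, c) - (case y - (c, c) of (h, k) \<Rightarrow> b * h + b * k))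
          \<le> e * norm (y - (c, c))" if y: "norm (y - (c, c)) < d" for y
  proof -
    obtain z w where zw: "y = (z, w)" by force
    define r where "r = norm (y - (c, c))"
    have nz: "norm (z - c) \<le> r" and nw: "norm (w - c) \<le> r"
      using norm_fst_le[of "z - c" "w - c"] norm_snd_le[of "w - c" "z - c"]
      by (auto simp: r_def zw)
    define g where "g = (\<lambda>u. f u - deriv f c * u - b * (u - c)\<^sup>2)"
    define g' where "g' = (\<lambda>u. deriv f u - deriv f c - 2 * b * (u - c))"
    have bd: "norm (g' u) \<le> e * r" if "u \<in> cball c r" for u
    proof -
      have u: "norm (u - c) \<le> r"
        using that by (simp add: dist_norm norm_minus_commute)
      moreover have "norm (u - c) < d1"
        using u y by (simp add: r_def d_def)
      ultimately show ?thesis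
        using d1(2)[of u] mult_left_mono[OF u, of e] e unfolding g'_def by linarith
    qed
    have der: "(g has_field_derivative g' u) (at u within cball c r)" if "u \<in> cball c r" for u
    proof -
      have "u \<in> S" using that y d2(2) by (auto simp: r_def d_def subset_iff)
      from holomorphic_derivI[OF f S this] show ?thesis
        unfolding g_def g'_def by (auto intro!: derivative_eq_intros)
    qed
    have zw_in: "z \<in> cball c r" "w \<in> cball c r"
      using nz nw by (auto simp: dist_norm norm_minus_commute)
    have "norm (sym_lift f (z, w) - deriv f c - (b * (z - c) + b * (w - c))) \<le> e * r"
    proof (cases "z = w")
      case True
      then have "sym_lift f (z, w) - deriv f c - (b * (z - c) + b * (w - c)) = g' z"
        by (simp add: sym_lift_def g'_def algebra_simps)
      then show ?thesis using bd[OF zw_in(1)] by simp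
    next
      case False
      have "g z - g w = (f z - f w) - (z - w) * (deriv f c + b * (z - c) + b * (w - c))"
        unfolding g_def by (simp add: algebra_simps power2_eq_square)
      then have "sym_lift f (z, w) - deriv f c - (b * (z - c) + b * (w - c)) = (g z - g w) / (z - w)"
        using False by (simp add: sym_lift_def diff_divide_distrib)
      moreover have "norm (g z - g w) \<le> e * r * norm (z - w)"
        by (rule field_differentiable_bound[OF convex_cball der bd]) (use zw_in in auto)
      ultimately show ?thesis
        using False by (simp only: norm_divide) (simp add: pos_divide_le_eq)
    qed
    then show ?thesis by (simp add: zw r_def sym_lift_def)
  qed
  then show "\<exists>d>0. \<forall>y. norm (y - (c, c)) < d \<longrightarrow>
      norm (sym_lift f y - sym_lift f (c, c) - (case y - (c, c) of (h, k) \<Rightarrow> b * h + b * k))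
        \<le> e * norm (y - (c, c))"
    using d1(1) d2(1) by (intro exI[of _ d]) (auto simp: d_def)
qed

lemma sym_lift_has_derivative_off_diagonal:
  assumes f: "f holomorphic_on S" and S: "open S" and zw: "z \<in> S" "w \<in> S" "z \<noteq> w"
  shows "\<exists>a b. (sym_lift f has_derivative (\<lambda>(h, k). a * h + b * k)) (at (z, w))"
proof -
  let ?q = "(f z - f w) / (z - w)"
  have "(f has_derivative (\<lambda>h. deriv f z * h)) (at z)" "(f has_derivative (\<lambda>h. deriv f w * h)) (at w)"
    using holomorphic_derivI[OF f S] zw unfolding has_field_derivative_def by auto
  then have "((\<lambda>x. f (fst x)) has_derivative (\<lambda>x. deriv f z * fst x)) (at (z, w))"
    "((\<lambda>x. f (snd x)) has_derivative (\<lambda>x. deriv f w * snd x)) (at (z, w))"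
    using has_derivative_compose[OF has_derivative_fst[OF has_derivative_ident], of f _ "(z, w)" UNIV]
      has_derivative_compose[OF has_derivative_snd[OF has_derivative_ident], of f _ "(z, w)" UNIV]
    by auto
  then have "((\<lambda>x. (f (fst x) - f (snd x)) / (fst x - snd x)) has_derivative
      (\<lambda>(h, k). ((deriv f z - ?q) / (z - w)) * h + ((?q - deriv f w) / (z - w)) * k)) (at (z, w))"
    using zw(3) by (auto intro!: derivative_eq_intros simp: fun_eq_iff divide_simps)
      (simp add: algebra_simps)
  moreover have "open {x :: complex \<times> complex. fst x \<noteq> snd x}"
    by (intro open_Collect_neq continuous_intros)
  ultimately have "(sym_lift f has_derivative
      (\<lambda>(h, k). ((deriv f z - ?q) / (z - w)) * h + ((?q - deriv f w) / (z - w)) * k)) (at (z, w))"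
    by (rule has_derivative_transform_within_open) (use zw(3) in \<open>auto simp: sym_lift_def\<close>)
  then show ?thesis by blast
qed

lemma holomorphic2_sym_lift:
  assumes "f holomorphic_on unit_disk"
  shows "holomorphic2_on (sym_lift f) bidisk"
  unfolding holomorphic2_on_def
proof safe
  fix z w :: complex assume zw: "z \<in> unit_disk" "w \<in> unit_disk"
  have "\<exists>a b. (sym_lift f has_derivative (\<lambda>(h, k). a * h + b * k)) (at (z, w))"
    using sym_lift_has_derivative_diagonal[OF assms open_ball zw(1)]
      sym_lift_has_derivative_off_diagonal[OF assms open_ball zw] by blast
  then show "\<exists>a b. (sym_lift f has_derivative (\<lambda>(h, k). a * h + b * k)) (at (z, w) within bidisk)"
    by (blast intro: has_derivative_at_withinI)
qed

lemma sym_lift_in_bergman_space2: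
  assumes "sym_lift_maps_boundedly \<alpha> p" and f: "f \<in> bergman_space \<alpha> p"
  shows "sym_lift f \<in> bergman_space2 \<alpha> p"
proof -
  obtain C :: real where
    "bergman_integral2 \<alpha> p (sym_lift f) \<le> ennreal C * bergman_integral \<alpha> p f"
    using assms unfolding sym_lift_maps_boundedly_def by blast
  also have "\<dots> < \<infinity>"
    using f by (simp add: bergman_space_def ennreal_mult_less_top)
  finally show ?thesis
    using f holomorphic2_sym_lift by (simp add: bergman_space_def bergman_space2_def)
qed

end

theory Submission
  imports Defs "HOL-Real_Asymp.Real_Asymp"
begin

text \<open>Write \<open>\<mu>\<close> for the weighted area measure and \<open>k u w = cmod (1 - cnj u * w)\<close>. The positive half rests on
the slice estimate \<open>sym_lift_slice_bound\<close>: for each \<open>w\<close>, the integral of \<open>|L f (\<cdot>, w)|\<^sup>p\<close> against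
\<open>\<mu>\<close> is at most a constant times the integral of \<open>(|f u|\<^sup>p + |f w|\<^sup>p) / (k u w) powr p\<close> against \<open>d\<mu> u\<close>.
Integrating over \<open>w\<close>, Tonelli's theorem and the symmetry of \<open>k\<close> reduce the claim to the Forelli--Rudin
estimate \<open>forelli_rudin\<close>: the integral of \<open>1 / (k u w) powr p\<close> against \<open>d\<mu> w\<close> is bounded uniformly in
\<open>u\<close>, and this is where \<open>p < \<alpha> + 2\<close> enters.

The slice estimate splits the disk at \<open>|z - w| = (1 - |w|) / 4\<close>. Far from the diagonal \<open>k z w\<close> is at
most a multiple of \<open>|z - w|\<close>, and the triangle inequality applied to the difference quotient is enough.
Near the diagonal the quotient is controlled by the derivative of \<open>f\<close>, hence by the maximum of \<open>|f|\<close> on a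
slightly larger disk, hence by an area integral of \<open>|f|\<^sup>p\<close>
(\<open>norm_powr_le_integral_ball\<close>, valid for all \<open>p > 0\<close>); on that disk the weight is comparable to
\<open>(1 - |w|) powr \<alpha>\<close> and \<open>k\<close> is at most \<open>3 * (1 - |w|)\<close>.

The Forelli--Rudin estimate is obtained in Cartesian coordinates. Since \<open>k u w\<close> dominates both
\<open>(1 - |w|\<^sup>2) / 2\<close> and \<open>|Re w - Re u|\<close>, the factor \<open>(k u w) powr -p\<close> splits into powers of these two with
exponents \<open>-s\<close> and \<open>-(p - s)\<close>. Where \<open>2 * (Re w)\<^sup>2 \<le> 1\<close>, the unit circle consists of two graphs over the real
axis and the resulting product can be integrated one variable at a time provided \<open>\<alpha> - s > -1\<close> and
\<open>p - s < 1\<close>; such an \<open>s\<close> between \<open>0\<close> and \<open>p\<close> exists exactly when \<open>p < \<alpha> + 2\<close>. The rest of the disk follows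
by exchanging the real and imaginary parts.

For the negative half take \<open>f z = 1 / (1 - r * z)\<close> with \<open>0 < r < 1\<close>. Its lift factorises as
\<open>r * f z * f w\<close>, so boundedness would force \<open>r powr p * I\<^sup>2 \<le> C * I\<close> for the integral \<open>I\<close> of \<open>|f|\<^sup>p\<close>, that
is, \<open>r powr p * I \<le> C\<close>. But \<open>I\<close> is at least a constant times \<open>(1 - r) powr (\<alpha> + 2 - p)\<close>, which tends to
infinity as \<open>r\<close> tends to \<open>1\<close> when \<open>p > \<alpha> + 2\<close>.\<close>

section \<open>Area integrals in Cartesian coordinates\<close>

lemma borel_measurable_Complex [measurable]:
  "(\<lambda>(x, y). Complex x y) \<in> borel_measurable (borel \<Otimes>\<^sub>M borel)"
  unfolding borel_prod split_def
  by (intro borel_measurable_continuous_onI continuous_intros)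

text \<open>Both measures give a box the product of its side lengths, and this determines Lebesgue measure.\<close>

lemma lborel_complex_eq_distr:
  "(lborel :: complex measure) = distr (lborel \<Otimes>\<^sub>M lborel) borel (\<lambda>(x, y). Complex x y)"
proof (rule lborel_eqI)
  fix l u :: complex
  assume "\<And>b. b \<in> Basis \<Longrightarrow> l \<bullet> b \<le> u \<bullet> b"
  then have le: "Re l \<le> Re u" "Im l \<le> Im u"
    by (force simp: Basis_complex_def)+
  have "emeasure (distr (lborel \<Otimes>\<^sub>M lborel) borel (\<lambda>(x, y). Complex x y)) (box l u)
      = emeasure (lborel \<Otimes>\<^sub>M lborel) ({Re l<..<Re u} \<times> {Im l<..<Im u})"
    by (subst emeasure_distr)
      (auto simp: box_def Basis_complex_def space_pair_measure intro!: arg_cong2[where f = emeasure])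
  also have "\<dots> = ennreal (\<Prod>b\<in>Basis. (u - l) \<bullet> b)"
    using le by (simp add: lborel.emeasure_pair_measure_Times Basis_complex_def ennreal_mult')
  finally show "emeasure (distr (lborel \<Otimes>\<^sub>M lborel) borel (\<lambda>(x, y). Complex x y)) (box l u)
      = ennreal (\<Prod>b\<in>Basis. (u - l) \<bullet> b)" .
qed simp

lemma nn_integral_complex_iterated:
  fixes g :: "complex \<Rightarrow> ennreal"
  assumes [measurable]: "g \<in> borel_measurable borel"
  shows "(\<integral>\<^sup>+w. g w \<partial>lborel) = (\<integral>\<^sup>+x. (\<integral>\<^sup>+y. g (Complex x y) \<partial>lborel) \<partial>lborel)"
  by (subst lborel_complex_eq_distr, subst nn_integral_distr)
    (auto simp: split_def lborel.nn_integral_fst[symmetric])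

lemma nn_integral_complex_swap:
  fixes g :: "complex \<Rightarrow> ennreal"
  assumes [measurable]: "g \<in> borel_measurable borel"
  shows "(\<integral>\<^sup>+w. g (Complex (Im w) (Re w)) \<partial>lborel) = (\<integral>\<^sup>+w. g w \<partial>lborel)"
proof -
  have "(\<integral>\<^sup>+w. g (Complex (Im w) (Re w)) \<partial>lborel)
      = (\<integral>\<^sup>+x. (\<integral>\<^sup>+y. g (Complex y x) \<partial>lborel) \<partial>lborel)"
    by (subst nn_integral_complex_iterated) (auto simp: Complex_eq)
  also have "\<dots> = (\<integral>\<^sup>+y. (\<integral>\<^sup>+x. g (Complex y x) \<partial>lborel) \<partial>lborel)"
    by (rule lborel_pair.Fubini') simp
  finally show ?thesis
    by (simp add: nn_integral_complex_iterated)
qed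

lemma emeasure_disk: "r \<ge> 0 \<Longrightarrow> emeasure lborel (ball (c::complex) r) = ennreal (pi * r\<^sup>2)"
  by (subst emeasure_ball) (auto simp: unit_ball_vol_2)

text \<open>The absolute value of the exponent lets one inequality serve positive and negative powers alike.\<close>

lemma powr_le_powr_abs_mult:
  fixes x y k e :: real
  assumes "0 < y" "x \<le> k * y" "y \<le> k * x" "k \<ge> 1"
  shows "x powr e \<le> k powr \<bar>e\<bar> * y powr e"
proof -
  have x: "x > 0" using assms by (smt (verit) mult_nonneg_nonpos)
  show ?thesis
  proof (cases "e \<ge> 0")
    case True
    then have "x powr e \<le> (k * y) powr e"
      using assms x by (intro powr_mono2) auto
    then show ?thesis using True assms by (simp add: powr_mult)
  next
    case False
    have "y / k \<le> x"
      using assms by (simp add: field_simps)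
    then have "x powr e \<le> (y / k) powr e"
      using False assms by (intro powr_mono2') auto
    also have "\<dots> = k powr \<bar>e\<bar> * y powr e"
      using False assms by (simp add: powr_divide powr_minus field_simps)
    finally show ?thesis .
  qed
qed

lemma nn_integral_abs_powr:
  fixes a e :: real
  assumes "e > -1"
  shows "(\<integral>\<^sup>+x. ennreal (indicator {..2} \<bar>x - a\<bar> * \<bar>x - a\<bar> powr e) \<partial>lborel) \<le> ennreal (2 * (2 powr (e + 1) / (e + 1)))"
proof -
  let ?h = "\<lambda>u::real. ennreal (indicator {0..2} u * u powr e)"
  define V where "V = 2 powr (e + 1) / (e + 1)"
  have V: "(\<integral>\<^sup>+u. ?h u \<partial>lborel) = ennreal V" "V \<ge> 0"
    using nn_integral_has_integral_lebesgue[OF _ has_integral_powr_from_0[of e 2]] assms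
    by (auto simp: V_def)
  have "(\<integral>\<^sup>+x. ennreal (indicator {..2} \<bar>x - a\<bar> * \<bar>x - a\<bar> powr e) \<partial>lborel)
      \<le> (\<integral>\<^sup>+x. ?h (- a + 1 * x) + ?h (a + (-1) * x) \<partial>lborel)"
    by (rule nn_integral_mono) (auto simp: indicator_def abs_if algebra_simps)
  also have "\<dots> = (\<integral>\<^sup>+x. ?h (- a + 1 * x) \<partial>lborel) + (\<integral>\<^sup>+x. ?h (a + (-1) * x) \<partial>lborel)"
    by (rule nn_integral_add) auto
  also have "(\<integral>\<^sup>+x. ?h (- a + 1 * x) \<partial>lborel) = ennreal V"
    using nn_integral_real_affine[of ?h 1 "- a"] V by simp
  also have "(\<integral>\<^sup>+x. ?h (a + (-1) * x) \<partial>lborel) = ennreal V"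
    using nn_integral_real_affine[of ?h "-1" a] V by simp
  also have "ennreal V + ennreal V = ennreal (2 * V)"
    using V by (simp flip: ennreal_plus)
  finally show ?thesis by (simp add: V_def)
qed

section \<open>The kernel of the disk\<close>

text \<open>The identity behind the pseudo-hyperbolic distance. As both factors of the second summand are positive
inside the disk, it gives \<open>dist_le_norm_one_minus_cnj_mult\<close>.\<close>

lemma one_minus_cnj_mult:
  fixes u w :: complex
  shows "(cmod (1 - cnj u * w))\<^sup>2 = (cmod (w - u))\<^sup>2 + (1 - (cmod u)\<^sup>2) * (1 - (cmod w)\<^sup>2)"
  by (simp add: cmod_power2 algebra_simps) (simp add: power2_eq_square algebra_simps)

lemma dist_le_norm_one_minus_cnj_mult:
  assumes "cmod u < 1" "cmod w < 1"
  shows "cmod (w - u) \<le> cmod (1 - cnj u * w)"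
proof (rule power2_le_imp_le)
  have "(1 - (cmod u)\<^sup>2) * (1 - (cmod w)\<^sup>2) \<ge> 0"
    using assms by (intro mult_nonneg_nonneg) (auto simp: power_le_one)
  then show "(cmod (w - u))\<^sup>2 \<le> (cmod (1 - cnj u * w))\<^sup>2"
    by (simp add: one_minus_cnj_mult)
qed simp

lemma one_minus_norm_sq_le:
  assumes "cmod u < 1" "cmod w < 1"
  shows "1 - (cmod w)\<^sup>2 \<le> 2 * cmod (1 - cnj u * w)"
proof -
  have "1 - cmod u * cmod w \<le> cmod (1 - cnj u * w)"
    using norm_triangle_ineq2[of 1 "cnj u * w"] by (simp add: norm_mult)
  moreover have "cmod u * cmod w \<le> 1 * cmod w"
    using assms by (intro mult_right_mono) auto
  moreover have "0 \<le> (1 - cmod w)^2" by simp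
  ultimately show ?thesis by (simp add: power2_eq_square algebra_simps)
qed

lemma norm_one_minus_cnj_mult_le:
  assumes w: "w \<in> unit_disk"
  shows "cmod (1 - cnj z * w) \<le> 2 * (1 - cmod w) + cmod (z - w)"
proof -
  have "1 - cnj w * w = of_real (1 - (cmod w)\<^sup>2)"
    by (simp add: complex_norm_square mult.commute del: of_real_power)
  then have 1: "cmod (1 - cnj w * w) = 1 - (cmod w)\<^sup>2"
    using w by (simp only: norm_of_real) (simp add: power_le_one)
  have "1 - cnj z * w = (1 - cnj w * w) + cnj (w - z) * w"
    by (simp add: algebra_simps)
  then have 2: "cmod (1 - cnj z * w) \<le> cmod (1 - cnj w * w) + cmod (cnj (w - z) * w)"
    using norm_triangle_ineq by metis
  have 3: "cmod (cnj (w - z) * w) \<le> cmod (z - w) * 1"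
    unfolding norm_mult complex_mod_cnj using w by (intro mult_mono) (auto simp: norm_minus_commute)
  have "1 - (cmod w)\<^sup>2 \<le> 2 * (1 - cmod w)"
    using zero_le_power2[of "1 - cmod w"] by (simp add: power2_eq_square algebra_simps)
  with 1 2 3 show ?thesis by linarith
qed

text \<open>On a disk about \<open>w\<close> whose radius is a fixed fraction, less than one, of the distance to the unit circle,
the quantities \<open>1 - |u|\<close>, \<open>1 - |u|\<^sup>2\<close> and \<open>1 - |w|\<close> agree up to a constant factor.\<close>

lemma weight_comparable_near:
  assumes w: "w \<in> unit_disk" and u: "u \<in> ball w (3 / 4 * (1 - cmod w))"
  shows "u \<in> unit_disk" (is ?A)
    and "(1 - (cmod u)\<^sup>2) powr \<alpha> \<le> 4 powr \<bar>\<alpha>\<bar> * (1 - cmod w) powr \<alpha>" (is ?B)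
    and "(1 - cmod w) powr \<alpha> \<le> 4 powr \<bar>\<alpha>\<bar> * (1 - (cmod u)\<^sup>2) powr \<alpha>" (is ?C)
    and "cmod (1 - cnj u * w) \<le> 3 * (1 - cmod w)" (is ?D)
proof -
  define d where "d = 1 - cmod w"
  have d: "d > 0" using w by (simp add: d_def)
  have uw: "cmod (u - w) < 3 / 4 * d" using u by (simp add: dist_norm norm_minus_commute d_def)
  have 1: "1 - cmod u > d / 4"
    using uw norm_triangle_ineq2[of u w] d_def by linarith
  have 2: "1 - cmod u < 7 / 4 * d"
    using uw norm_triangle_ineq2[of w u] norm_minus_commute[of w u] d_def by linarith
  show ?A using 1 d by simp
  then have u1: "cmod u < 1" by simp
  have "(cmod u)\<^sup>2 \<le> cmod u" "1 - (cmod u)\<^sup>2 \<le> 2 * (1 - cmod u)"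
    using u1 zero_le_power2[of "1 - cmod u"]
    by (simp_all add: power2_eq_square mult_left_le algebra_simps)
  then have 3: "1 - (cmod u)\<^sup>2 \<le> 4 * d" "d \<le> 4 * (1 - (cmod u)\<^sup>2)"
    using 1 2 d by argo+
  then have 4: "1 - (cmod u)\<^sup>2 > 0" using d by argo
  show ?B ?C
    using powr_le_powr_abs_mult[OF d 3, of \<alpha>] powr_le_powr_abs_mult[OF 4 3(2) 3(1), of \<alpha>]
    by (auto simp: d_def)
  show ?D using norm_one_minus_cnj_mult_le[OF w, of u] uw d unfolding d_def by argo
qed

text \<open>Away from \<open>w\<close> the distance \<open>1 - |w|\<close> is itself at most \<open>4 * |z - w|\<close>.\<close>

lemma norm_one_minus_cnj_mult_le_dist:
  assumes w: "w \<in> unit_disk" and z: "z \<notin> ball w (1 / 4 * (1 - cmod w))"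
  shows "cmod (1 - cnj z * w) \<le> 9 * cmod (z - w)"
proof -
  have "1 - cmod w \<le> 4 * cmod (z - w)"
    using z by (simp add: dist_norm norm_minus_commute)
  then have "2 * (1 - cmod w) + cmod (z - w) \<le> 9 * cmod (z - w)" by simp
  with norm_one_minus_cnj_mult_le[OF w, of z] show ?thesis by (rule order_trans)
qed

section \<open>Forelli--Rudin estimate\<close>

text \<open>Over the part of the disk with \<open>2 * (Re w)\<^sup>2 \<le> 1\<close> the unit circle is the pair of graphs
\<open>\<plusminus>S\<close> with \<open>S = sqrt (1 - x\<^sup>2)\<close> bounded below, and \<open>1 - |w|\<^sup>2 = (S - |y|) * (S + |y|)\<close> is comparable to
the vertical distance \<open>S - |y|\<close> to the circle. The integrand is therefore at most a constant times
\<open>(S - |y|) powr e * |x - Re u| powr -t\<close>, whose two factors are integrable one variable at a time.\<close>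

lemma forelli_rudin_half:
  fixes \<alpha> p :: real
  assumes \<alpha>: "\<alpha> > -1" and p: "0 < p" "p < \<alpha> + 2"
  shows "\<exists>C\<ge>0. \<forall>u. cmod u < 1 \<longrightarrow>
    (\<integral>\<^sup>+w. ennreal (indicator {w\<in>ball 0 1. 2 * (Re w)\<^sup>2 \<le> 1} w *
       ((1 - (cmod w)\<^sup>2) powr \<alpha> * cmod (1 - cnj u * w) powr (- p))) \<partial>lborel) \<le> ennreal C"
proof -
  \<comment> \<open>The part \<open>s\<close> of the exponent \<open>p\<close> that is charged to the distance from the circle: \<open>s < \<alpha> + 1\<close> makes
  the vertical integral converge, \<open>p - s < 1\<close> the horizontal one.\<close>
  have "max 0 (p - 1) < min p (\<alpha> + 1)" using assms by auto
  from dense[OF this] obtain s where s: "0 < s" "p - 1 < s" "s < p" "s < \<alpha> + 1" by auto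
  define e where "e = \<alpha> - s"
  define t where "t = p - s"
  define P :: "real \<Rightarrow> real" where "P = (\<lambda>e. 2 * (2 powr (e + 1) / (e + 1)))"
  define M :: real where "M = 2 powr s * 2 powr \<bar>e\<bar>"
  have et: "e > -1" "- t > -1" "t > 0" using s by (auto simp: e_def t_def)
  have P0: "P e \<ge> 0" "P (-t) \<ge> 0" using et by (auto simp: P_def)
  have M0: "M \<ge> 0" by (simp add: M_def)
  have main: "(\<integral>\<^sup>+w. ennreal (indicator {w\<in>ball 0 1. 2 * (Re w)\<^sup>2 \<le> 1} w *
       ((1 - (cmod w)\<^sup>2) powr \<alpha> * cmod (1 - cnj u * w) powr (- p))) \<partial>lborel)
      \<le> ennreal (M * (2 * P e) * P (-t))" if u: "cmod u < 1" for u
  proof -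
    let ?f = "\<lambda>w. indicator {w\<in>ball 0 1. 2 * (Re w)\<^sup>2 \<le> 1} w *
       ((1 - (cmod w)\<^sup>2) powr \<alpha> * cmod (1 - cnj u * w) powr (- p))"
    let ?I = "\<lambda>(e::real) (x::real). ennreal (indicator {..2} \<bar>x\<bar> * \<bar>x\<bar> powr e)"
    define a where "a = Re u"
    have a: "\<bar>a\<bar> < 1" using u abs_Re_le_cmod[of u] by (simp add: a_def)
    have pt: "ennreal (?f (Complex x y)) \<le> ennreal M * ?I (-t) (x - a) *
        (?I e (y - sqrt (1 - x\<^sup>2)) + ?I e (y - (- sqrt (1 - x\<^sup>2))))"
      \<comment> \<open>On the line \<open>x = a\<close> the bound fails, because \<open>0 powr (-t)\<close> is \<open>0\<close> by convention; the line is a null set.\<close>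
      if x: "x \<noteq> a" for x y
    proof (cases "Complex x y \<in> ball 0 1 \<and> 2 * x\<^sup>2 \<le> 1")
      case False
      then show ?thesis by (auto simp: indicator_def)
    next
      case True
      define S where "S = sqrt (1 - x\<^sup>2)"
      define w where "w = Complex x y"
      have w: "cmod w < 1" using True by (simp add: w_def)
      then have n: "x\<^sup>2 + y\<^sup>2 < 1"
        by (simp add: w_def cmod_def)
      have x2: "2 * x\<^sup>2 \<le> 1" using True by simp
      have S2: "S\<^sup>2 = 1 - x\<^sup>2" and S0: "S \<ge> 0" using x2 by (auto simp: S_def)
      have yS: "\<bar>y\<bar> < S"
        using n S2 S0 by (intro power_less_imp_less_base[of "\<bar>y\<bar>" 2 S]) auto
      have S1: "S \<le> 1" using S2 by (intro power2_le_imp_le[of S 1]) auto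
      have "(1 / 2)\<^sup>2 \<le> S\<^sup>2" unfolding S2 using x2 by (simp add: power_divide)
      then have Sh: "1 / 2 \<le> S" using S0 by (rule power2_le_imp_le)
      have x1: "\<bar>x\<bar> \<le> 1" using x2 by (intro power2_le_imp_le[of "\<bar>x\<bar>" 1]) auto
      define r where "r = S - \<bar>y\<bar>"
      have r: "0 < r" "r \<le> 2" using yS S1 by (auto simp: r_def)
      have fac: "1 - (cmod w)\<^sup>2 = r * (S + \<bar>y\<bar>)"
        using S2 cmod_power2[of w] by (simp add: r_def w_def power2_eq_square algebra_simps)
      have d: "1 - (cmod w)\<^sup>2 > 0" using w by (simp add: power_less_one_iff abs_square_less_1)
      have "(1 - (cmod w)\<^sup>2) powr e \<le> 2 powr \<bar>e\<bar> * r powr e"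
      proof (rule powr_le_powr_abs_mult)
        have "r * (S + \<bar>y\<bar>) \<le> r * 2" using r yS S1 by (intro mult_left_mono) auto
        then show "1 - (cmod w)\<^sup>2 \<le> 2 * r" by (simp add: fac)
        have "r * (1/2) \<le> r * (S + \<bar>y\<bar>)" using r Sh by (intro mult_left_mono) auto
        then show "r \<le> 2 * (1 - (cmod w)\<^sup>2)" by (simp add: fac)
      qed (use r in auto)
      moreover have "cmod (1 - cnj u * w) powr (- p) \<le>
          2 powr s * (1 - (cmod w)\<^sup>2) powr (- s) * \<bar>x - a\<bar> powr (- t)"
      proof -
        have "\<bar>x - a\<bar> \<le> cmod (w - u)"
          using abs_Re_le_cmod[of "w - u"] by (simp add: a_def w_def)
        also have "\<dots> \<le> cmod (1 - cnj u * w)"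
          by (rule dist_le_norm_one_minus_cnj_mult[OF u w])
        finally have 1: "cmod (1 - cnj u * w) powr (- t) \<le> \<bar>x - a\<bar> powr (- t)"
          using x et by (intro powr_mono2') auto
        have 2: "cmod (1 - cnj u * w) powr (- s) \<le> ((1 - (cmod w)\<^sup>2) / 2) powr (- s)"
          using one_minus_norm_sq_le[OF u w] d s by (intro powr_mono2') auto
        have "cmod (1 - cnj u * w) powr (- p)
            = cmod (1 - cnj u * w) powr (- s) * cmod (1 - cnj u * w) powr (- t)"
          by (simp add: t_def flip: powr_add)
        also have "\<dots> \<le> ((1 - (cmod w)\<^sup>2) / 2) powr (- s) * \<bar>x - a\<bar> powr (- t)"
          by (intro mult_mono 1 2) auto
        also have "((1 - (cmod w)\<^sup>2) / 2) powr (- s) = 2 powr s * (1 - (cmod w)\<^sup>2) powr (- s)"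
          using d by (simp add: powr_divide powr_minus field_simps)
        finally show ?thesis .
      qed
      ultimately have "(1 - (cmod w)\<^sup>2) powr e * (1 - (cmod w)\<^sup>2) powr s * cmod (1 - cnj u * w) powr (- p)
         \<le> (2 powr \<bar>e\<bar> * r powr e) * (1 - (cmod w)\<^sup>2) powr s
            * (2 powr s * (1 - (cmod w)\<^sup>2) powr (- s) * \<bar>x - a\<bar> powr (- t))"
        by (intro mult_mono) auto
      also have "\<dots> = M * \<bar>x - a\<bar> powr (- t) * r powr e"
        using d by (simp add: M_def powr_minus field_simps)
      finally have le: "?f w \<le> M * \<bar>x - a\<bar> powr (- t) * r powr e"
        using True by (simp add: e_def w_def flip: powr_add)
      \<comment> \<open>\<open>r\<close> is the distance to the nearer of the two boundary points above and below \<open>x\<close>.\<close>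
      have "\<bar>y - S\<bar> = r \<or> \<bar>y - (- S)\<bar> = r" using yS by (auto simp: r_def)
      then have "ennreal (r powr e) \<le> ?I e (y - S) + ?I e (y - (- S))"
        using r by (elim disjE) (simp_all add: add_increasing add_increasing2)
      moreover have "ennreal (?f w) \<le> ennreal M * ?I (-t) (x - a) * ennreal (r powr e)"
        using le x1 a M0 by (simp add: ennreal_mult'[symmetric] ennreal_leI)
      ultimately show ?thesis
        unfolding w_def[symmetric] S_def[symmetric]
        by (meson mult_left_mono order_trans zero_le)
    qed
    have inner: "(\<integral>\<^sup>+y. ennreal (?f (Complex x y)) \<partial>lborel)
        \<le> ennreal M * ?I (-t) (x - a) * ennreal (2 * P e)" if x: "x \<noteq> a" for x
    proof -
      let ?S = "sqrt (1 - x\<^sup>2)"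
      have "(\<integral>\<^sup>+y. ennreal (?f (Complex x y)) \<partial>lborel)
        \<le> (\<integral>\<^sup>+y. ennreal M * ?I (-t) (x - a) * (?I e (y - ?S) + ?I e (y - (- ?S))) \<partial>lborel)"
        by (intro nn_integral_mono pt x)
      also have "\<dots> = ennreal M * ?I (-t) (x - a) *
          ((\<integral>\<^sup>+y. ?I e (y - ?S) \<partial>lborel) + (\<integral>\<^sup>+y. ?I e (y - (- ?S)) \<partial>lborel))"
        by (subst nn_integral_cmult, simp) (subst nn_integral_add, simp_all)
      also have "\<dots> \<le> ennreal M * ?I (-t) (x - a) * (ennreal (P e) + ennreal (P e))"
        unfolding P_def by (intro mult_left_mono add_mono nn_integral_abs_powr et) auto
      finally show ?thesis using P0 by (simp flip: ennreal_plus)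
    qed
    have "(\<integral>\<^sup>+w. ennreal (?f w) \<partial>lborel) = (\<integral>\<^sup>+x. (\<integral>\<^sup>+y. ennreal (?f (Complex x y)) \<partial>lborel) \<partial>lborel)"
      by (rule nn_integral_complex_iterated) simp
    also have "\<dots> \<le> (\<integral>\<^sup>+x. ennreal M * ?I (-t) (x - a) * ennreal (2 * P e) \<partial>lborel)"
      using AE_lborel_singleton[of a] inner by (intro nn_integral_mono_AE) (rule eventually_mono)
    also have "\<dots> = (\<integral>\<^sup>+x. ennreal M * ennreal (2 * P e) * ?I (-t) (x - a) \<partial>lborel)"
      by (simp only: mult_ac)
    also have "\<dots> = ennreal M * ennreal (2 * P e) * (\<integral>\<^sup>+x. ?I (-t) (x - a) \<partial>lborel)"
      by (rule nn_integral_cmult) simp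
    also have "\<dots> \<le> ennreal M * ennreal (2 * P e) * ennreal (P (-t))"
      unfolding P_def by (intro mult_left_mono nn_integral_abs_powr et) auto
    also have "\<dots> = ennreal (M * (2 * P e) * P (-t))"
      using M0 P0 by (simp add: ennreal_mult)
    finally show ?thesis .
  qed
  show ?thesis
    using main M0 P0 by (intro exI[of _ "M * (2 * P e) * P (-t)"]) auto
qed

text \<open>The disk is covered by the set where \<open>2 * (Re w)\<^sup>2 \<le> 1\<close> and its image under exchange of real and
imaginary parts; the exchange conjugates \<open>1 - cnj u * w\<close> and so leaves the kernel unchanged.\<close>

lemma forelli_rudin_lborel:
  fixes \<alpha> p :: real
  assumes \<alpha>: "\<alpha> > -1" and p: "0 < p" "p < \<alpha> + 2"
  obtains C where "C \<ge> 0" "\<And>u. cmod u < 1 \<Longrightarrow>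
    (\<integral>\<^sup>+w. ennreal (indicator (ball 0 1) w *
       ((1 - (cmod w)\<^sup>2) powr \<alpha> * cmod (1 - cnj u * w) powr (- p))) \<partial>lborel) \<le> ennreal C"
proof -
  let ?k = "\<lambda>u w. (1 - (cmod w)\<^sup>2) powr \<alpha> * cmod (1 - cnj u * w) powr (- p)"
  let ?A = "{w\<in>ball (0::complex) 1. 2 * (Re w)\<^sup>2 \<le> 1}"
  let ?f = "\<lambda>u w. ennreal (indicator ?A w * ?k u w)"
  obtain C where C: "C \<ge> 0" "\<And>u. cmod u < 1 \<Longrightarrow> (\<integral>\<^sup>+w. ?f u w \<partial>lborel) \<le> ennreal C"
    using forelli_rudin_half[OF assms] by blast
  let ?T = "\<lambda>w. Complex (Im w) (Re w)"
  have "(\<integral>\<^sup>+w. ennreal (indicator (ball 0 1) w * ?k u w) \<partial>lborel) \<le> ennreal (2 * C)"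
    if u: "cmod u < 1" for u
  proof -
    have nT: "cmod (?T w) = cmod w" for w by (simp add: cmod_def add.commute)
    have kT: "?k (?T u) (?T w) = ?k u w" for w
    proof -
      have "1 - cnj (?T u) * ?T w = cnj (1 - cnj u * w)"
        by (simp add: complex_eq_iff algebra_simps)
      then show ?thesis by (simp only: nT complex_mod_cnj)
    qed
    have "(\<integral>\<^sup>+w. ennreal (indicator (ball 0 1) w * ?k u w) \<partial>lborel)
        \<le> (\<integral>\<^sup>+w. ?f u w + ?f (?T u) (?T w) \<partial>lborel)"
    proof (rule nn_integral_mono)
      fix w :: complex
      show "ennreal (indicator (ball 0 1) w * ?k u w) \<le> ?f u w + ?f (?T u) (?T w)"
      proof (cases "w \<in> ball 0 1")
        case True
        then have "(Re w)\<^sup>2 + (Im w)\<^sup>2 < 1" by (simp add: cmod_def)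
        then have "2 * (Re w)\<^sup>2 \<le> 1 \<or> 2 * (Im w)\<^sup>2 \<le> 1" by linarith
        then show ?thesis
          unfolding kT using True
          by (elim disjE) (simp_all add: nT add_increasing add_increasing2)
      qed simp
    qed
    also have "\<dots> = (\<integral>\<^sup>+w. ?f u w \<partial>lborel) + (\<integral>\<^sup>+w. ?f (?T u) (?T w) \<partial>lborel)"
      by (rule nn_integral_add) (simp_all add: Complex_eq)
    also have "(\<integral>\<^sup>+w. ?f (?T u) (?T w) \<partial>lborel) = (\<integral>\<^sup>+w. ?f (?T u) w \<partial>lborel)"
      by (rule nn_integral_complex_swap) simp
    also have "(\<integral>\<^sup>+w. ?f u w \<partial>lborel) + (\<integral>\<^sup>+w. ?f (?T u) w \<partial>lborel) \<le> ennreal C + ennreal C"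
      using u by (intro add_mono C) (simp_all add: nT)
    finally show ?thesis using C by (simp flip: ennreal_plus)
  qed
  then show ?thesis using that[of "2 * C"] C by auto
qed

section \<open>Weighted area as a density\<close>

lemma unit_disk_measurable [measurable]: "unit_disk \<in> sets borel"
  by simp

lemma cnj_measurable [measurable]: "cnj \<in> borel_measurable borel"
  by (intro borel_measurable_continuous_onI continuous_intros)

definition bergman_weight :: "real \<Rightarrow> complex \<Rightarrow> real" where
  "bergman_weight \<alpha> z = (\<alpha> + 1) / pi * (1 - (cmod z)\<^sup>2) powr \<alpha> * indicator unit_disk z"

lemma bergman_weight_measurable [measurable]: "bergman_weight \<alpha> \<in> borel_measurable borel"
  unfolding bergman_weight_def by simp

lemma weighted_area_eq_density:
  assumes "\<alpha> > -1"
  shows "weighted_area \<alpha> = density lborel (\<lambda>z. ennreal (bergman_weight \<alpha> z))"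
proof -
  have pi: "emeasure lborel unit_disk = ennreal pi"
    using emeasure_disk[of 1 0] by simp
  have "weighted_area \<alpha> = density lborel (\<lambda>z. indicator unit_disk z / ennreal pi *
      ennreal ((\<alpha> + 1) * (1 - (cmod z)\<^sup>2) powr \<alpha>))"
    unfolding weighted_area_def disk_area_def uniform_measure_def pi
    by (rule density_density_eq) simp_all
  also have "\<dots> = density lborel (\<lambda>z. ennreal (bergman_weight \<alpha> z))"
    using assms
    by (intro arg_cong[of _ _ "density lborel"] ext)
      (auto simp: bergman_weight_def indicator_def divide_ennreal ennreal_mult'[symmetric]
        simp flip: ennreal_1)
  finally show ?thesis .
qed

lemma sets_weighted_area [measurable_cong, simp]: "sets (weighted_area \<alpha>) = sets borel"
  by (simp add: weighted_area_def disk_area_def)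

lemma nn_integral_weighted_area:
  assumes "\<alpha> > -1" "g \<in> borel_measurable borel"
  shows "(\<integral>\<^sup>+z. g z \<partial>weighted_area \<alpha>) = (\<integral>\<^sup>+z. ennreal (bergman_weight \<alpha> z) * g z \<partial>lborel)"
  using assms by (simp add: weighted_area_eq_density nn_integral_density)

text \<open>The normalising constant \<open>(\<alpha> + 1) / pi\<close> of the weighted area measure is absorbed into \<open>C\<close>.\<close>

lemma forelli_rudin:
  fixes \<alpha> p :: real
  assumes \<alpha>: "\<alpha> > -1" and p: "0 < p" "p < \<alpha> + 2"
  obtains C where "C \<ge> 0" "\<And>u. u \<in> unit_disk \<Longrightarrow>
    (\<integral>\<^sup>+w. ennreal (cmod (1 - cnj u * w) powr (- p)) \<partial>weighted_area \<alpha>) \<le> ennreal C"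
proof -
  obtain C where C: "C \<ge> 0" "\<And>u. cmod u < 1 \<Longrightarrow>
    (\<integral>\<^sup>+w. ennreal (indicator (ball 0 1) w *
       ((1 - (cmod w)\<^sup>2) powr \<alpha> * cmod (1 - cnj u * w) powr (- p))) \<partial>lborel) \<le> ennreal C"
    using forelli_rudin_lborel[OF assms] by blast
  have "(\<integral>\<^sup>+w. ennreal (cmod (1 - cnj u * w) powr (- p)) \<partial>weighted_area \<alpha>)
      \<le> ennreal ((\<alpha> + 1) / pi * C)" if "u \<in> unit_disk" for u
  proof -
    have "(\<integral>\<^sup>+w. ennreal (cmod (1 - cnj u * w) powr (- p)) \<partial>weighted_area \<alpha>)
       = (\<integral>\<^sup>+w. ennreal ((\<alpha> + 1) / pi) * ennreal (indicator (ball 0 1) w *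
       ((1 - (cmod w)\<^sup>2) powr \<alpha> * cmod (1 - cnj u * w) powr (- p))) \<partial>lborel)"
      using \<alpha> by (subst nn_integral_weighted_area)
        (auto intro!: nn_integral_cong simp: bergman_weight_def ennreal_mult'[symmetric] mult_ac)
    also have "\<dots> = ennreal ((\<alpha> + 1) / pi) * (\<integral>\<^sup>+w. ennreal (indicator (ball 0 1) w *
       ((1 - (cmod w)\<^sup>2) powr \<alpha> * cmod (1 - cnj u * w) powr (- p))) \<partial>lborel)"
      by (rule nn_integral_cmult) simp
    also have "\<dots> \<le> ennreal ((\<alpha> + 1) / pi) * ennreal C"
      using that by (intro mult_left_mono C) auto
    also have "\<dots> = ennreal ((\<alpha> + 1) / pi * C)"
      using \<alpha> by (intro ennreal_mult'[symmetric]) simp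
    finally show ?thesis .
  qed
  moreover have "(\<alpha> + 1) / pi * C \<ge> 0" using \<alpha> C(1) by simp
  ultimately show ?thesis using that by blast
qed

text \<open>At \<open>u = 0\<close> the Forelli--Rudin kernel is constant.\<close>

lemma finite_measure_weighted_area:
  assumes "\<alpha> > -1"
  shows "finite_measure (weighted_area \<alpha>)"
proof
  obtain C where "C \<ge> 0" and C: "\<And>u. u \<in> unit_disk \<Longrightarrow>
    (\<integral>\<^sup>+w. ennreal (cmod (1 - cnj u * w) powr (- ((\<alpha> + 2) / 2))) \<partial>weighted_area \<alpha>) \<le> ennreal C"
    using forelli_rudin[of \<alpha> "(\<alpha> + 2) / 2"] assms by auto
  have "emeasure (weighted_area \<alpha>) (space (weighted_area \<alpha>)) \<le> ennreal C"
    using C[of 0] by simp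
  then show "emeasure (weighted_area \<alpha>) (space (weighted_area \<alpha>)) \<noteq> \<infinity>"
    by (auto simp: top_unique)
qed

section \<open>Local estimates for holomorphic functions\<close>

lemma norm_deriv_le_of_norm_bound:
  assumes f: "f holomorphic_on S" "open S" and r: "r > 0" "cball x r \<subseteq> S"
    and B: "\<And>v. v \<in> cball x r \<Longrightarrow> cmod (f v) \<le> B"
  shows "cmod (deriv f x) \<le> B / r"
proof -
  have "continuous_on (cball x r) f" "f holomorphic_on ball x r"
    using f r holomorphic_on_subset holomorphic_on_imp_continuous_on ball_subset_cball
    by (metis order_trans)+
  from Cauchy_inequality[OF this(2,1) r(1), of B 1] B show ?thesis
    by (simp add: dist_norm)
qed

text \<open>The sub-mean-value property of \<open>|f|\<^sup>p\<close>, up to a constant. For \<open>p < 1\<close> Jensen's inequality is not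
available, so the proof uses a maximal point instead: choose \<open>c\<close> maximising \<open>|f u| * (r - |u - z|) powr (2 / p)\<close>.
With \<open>d = r - |c - z|\<close> and \<open>m = |f c|\<close>, maximality gives \<open>|f| \<le> K * m\<close> on the disk of radius \<open>d / 2\<close>
about \<open>c\<close>, so by Cauchy's estimate \<open>|f| \<ge> m / 2\<close> on a disk whose radius is a fixed multiple of \<open>d\<close>.
The integral is thus at least a multiple of \<open>m\<^sup>p * d\<^sup>2\<close>, the \<open>p\<close>-th power of the maximum, which
dominates the value \<open>|f z|\<^sup>p * r\<^sup>2\<close> at the centre. The exponent \<open>2 / p\<close> is what matches the area \<open>d\<^sup>2\<close>.\<close>

lemma norm_powr_le_integral_ball:
  fixes p :: real
  assumes p: "p > 0"
  obtains C where "C > 0"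
    "\<And>f S z r. \<lbrakk>f holomorphic_on S; open S; r > 0; cball z r \<subseteq> S\<rbrakk> \<Longrightarrow>
      ennreal (cmod (f z) powr p * r\<^sup>2) \<le>
        ennreal C * (\<integral>\<^sup>+u. ennreal (cmod (f u) powr p) * indicator (ball z r) u \<partial>lborel)"
proof -
  \<comment> \<open>\<open>K\<close> is the loss when the distance to the boundary is halved.\<close>
  define K :: real where "K = 2 powr (2 / p)"
  have K: "K \<ge> 1" using p by (simp add: K_def ge_one_powr_ge_zero)
  define C where "C = 2 powr p * (8 * K)\<^sup>2 / pi"
  have C: "C > 0" using K by (simp add: C_def)
  have "ennreal (cmod (f z) powr p * r\<^sup>2) \<le>
      ennreal C * (\<integral>\<^sup>+u. ennreal (cmod (f u) powr p) * indicator (ball z r) u \<partial>lborel)"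
    if f: "f holomorphic_on S" "open S" and r: "r > 0" "cball z r \<subseteq> S" for f S z r
  proof (cases "f z = 0")
    case False
    define \<phi> where "\<phi> = (\<lambda>u. cmod (f u) * (r - cmod (u - z)) powr (2 / p))"
    have "continuous_on (cball z r) \<phi>"
      unfolding \<phi>_def using p f(1) r(2)
      by (intro continuous_intros continuous_on_powr' holomorphic_on_imp_continuous_on
            holomorphic_on_subset[OF f(1)])
        (auto simp: dist_norm norm_minus_commute)
    from continuous_attains_sup[OF compact_cball _ this] r(1)
    obtain c where c: "c \<in> cball z r" "\<And>v. v \<in> cball z r \<Longrightarrow> \<phi> v \<le> \<phi> c"
      by fastforce
    define d where "d = r - cmod (c - z)"
    define m where "m = cmod (f c)"
    have "\<phi> z > 0" using False r(1) by (simp add: \<phi>_def)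
    then have "\<phi> c > 0" using c(2)[of z] r(1) by simp
    moreover have "d \<ge> 0" using c(1) by (simp add: d_def dist_norm norm_minus_commute)
    ultimately have d: "d > 0" and m: "m > 0"
      by (auto simp: \<phi>_def d_def m_def zero_less_mult_iff)
    have sub: "v \<in> cball z r" "r - cmod (v - z) \<ge> d / 2" if "v \<in> cball c (d/2)" for v
    proof -
      have "cmod (v - z) \<le> cmod (v - c) + cmod (c - z)"
        using norm_triangle_ineq[of "v - c" "c - z"] by simp
      then show "v \<in> cball z r" "r - cmod (v - z) \<ge> d / 2"
        using that d by (auto simp: dist_norm norm_minus_commute d_def)
    qed
    have bd: "cmod (f v) \<le> K * m" if v: "v \<in> cball c (d/2)" for v
    proof -
      have "cmod (f v) * (d/2) powr (2/p) \<le> \<phi> v"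
        unfolding \<phi>_def using sub(2)[OF v] d p by (intro mult_left_mono powr_mono2) auto
      also have "\<dots> \<le> \<phi> c" by (rule c(2)[OF sub(1)[OF v]])
      also have "\<dots> = m * d powr (2/p)" by (simp add: \<phi>_def m_def d_def)
      finally show ?thesis using d by (simp add: powr_divide K_def field_simps)
    qed
    have der: "cmod (deriv f v) \<le> K * m / (d/4)" if v: "v \<in> cball c (d/4)" for v
    proof -
      have *: "cball v (d/4) \<subseteq> cball c (d/2)"
        using v by (simp add: cball_subset_cball_iff dist_commute)
      show ?thesis
      proof (rule norm_deriv_le_of_norm_bound[OF f])
        show "cball v (d/4) \<subseteq> S" using * sub(1) r(2) by blast
      qed (use * d bd in auto)
    qed
    define \<rho> where "\<rho> = d / (8 * K)"
    have \<rho>: "\<rho> > 0" "\<rho> \<le> d / 8" using d K by (auto simp: \<rho>_def field_simps)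
    have low: "m / 2 \<le> cmod (f v)" if v: "v \<in> ball c \<rho>" for v
    proof -
      have "norm (f v - f c) \<le> K * m / (d/4) * norm (v - c)"
      proof (rule field_differentiable_bound[OF convex_cball _ der])
        fix x assume "x \<in> cball c (d/4)"
        then have "x \<in> S" using sub(1)[of x] r(2) d by auto
        then show "(f has_field_derivative deriv f x) (at x within cball c (d/4))"
          by (rule holomorphic_derivI[OF f])
      qed (use v \<rho> d in auto)
      also have "\<dots> \<le> K * m / (d/4) * \<rho>"
        using v K m d by (intro mult_left_mono) (auto simp: dist_norm norm_minus_commute)
      also have "\<dots> = m / 2" using d K by (simp add: \<rho>_def field_simps)
      finally show ?thesis
        using norm_triangle_ineq2[of "f c" "f c - f v"] by (simp add: m_def norm_minus_commute)
    qed
    have "cmod (f z) * r powr (2/p) \<le> m * d powr (2/p)"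
      using c(2)[of z] r(1) by (simp add: \<phi>_def m_def d_def)
    then have "(cmod (f z) * r powr (2/p)) powr p \<le> (m * d powr (2/p)) powr p"
      using p by (intro powr_mono2) auto
    then have "cmod (f z) powr p * r\<^sup>2 \<le> m powr p * d\<^sup>2"
      using p d r m by (simp add: powr_mult powr_powr)
    also have "\<dots> = C * ((m/2) powr p * (pi * \<rho>\<^sup>2))"
      using d m K by (simp add: C_def \<rho>_def powr_divide power_divide)
    finally have "ennreal (cmod (f z) powr p * r\<^sup>2) \<le> ennreal (C * ((m/2) powr p * (pi * \<rho>\<^sup>2)))"
      by (rule ennreal_leI)
    also have "\<dots> = ennreal C * (\<integral>\<^sup>+u. ennreal ((m/2) powr p) * indicator (ball c \<rho>) u \<partial>lborel)"
      using \<rho> C by (subst nn_integral_cmult_indicator) (simp_all add: emeasure_disk ennreal_mult')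
    also have "\<dots> \<le> ennreal C * (\<integral>\<^sup>+u. ennreal (cmod (f u) powr p) * indicator (ball z r) u \<partial>lborel)"
    proof (intro mult_left_mono nn_integral_mono)
      fix u
      show "ennreal ((m/2) powr p) * indicator (ball c \<rho>) u \<le> ennreal (cmod (f u) powr p) * indicator (ball z r) u"
      proof (cases "u \<in> ball c \<rho>")
        case True
        then have "u \<in> cball c (d/2)" using \<rho> d by auto
        then have "u \<in> ball z r" using sub(2)[of u] d by (simp add: dist_norm norm_minus_commute)
        then show ?thesis using True low[OF True] m p by (auto intro!: ennreal_leI powr_mono2)
      qed simp
    qed simp
    finally show ?thesis .
  qed (use p in simp)
  with C show ?thesis using that by blast
qed

text \<open>The lift is a difference quotient, hence bounded by the derivative on the convex disk containing both points,
and Cauchy's estimate on circles of radius \<open>r\<close> bounds the derivative.\<close>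

lemma norm_sym_lift_le:
  assumes f: "f holomorphic_on S" "open S" and r: "r > 0" "cball w (2 * r) \<subseteq> S"
    and z: "z \<in> cball w r" and B: "\<And>v. v \<in> cball w (2 * r) \<Longrightarrow> cmod (f v) \<le> B"
  shows "cmod (sym_lift f (z, w)) \<le> B / r"
proof -
  have der: "cmod (deriv f v) \<le> B / r" if v: "v \<in> cball w r" for v
  proof -
    have "cball v r \<subseteq> cball w (2 * r)"
      using v by (simp add: cball_subset_cball_iff dist_commute)
    then show ?thesis
      using r by (intro norm_deriv_le_of_norm_bound[OF f] B) auto
  qed
  show ?thesis
  proof (cases "z = w")
    case True
    then show ?thesis using der[OF z] by (simp add: sym_lift_def)
  next
    case False
    have "cmod (f z - f w) \<le> B / r * cmod (z - w)"
    proof (rule field_differentiable_bound[OF convex_cball _ der])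
      fix x assume "x \<in> cball w r"
      then have "x \<in> S" using r by auto
      then show "(f has_field_derivative deriv f x) (at x within cball w r)"
        by (rule holomorphic_derivI[OF f])
    qed (use z r in auto)
    then show ?thesis using False by (simp add: sym_lift_def norm_divide pos_divide_le_eq)
  qed
qed

text \<open>Apply the sub-mean-value property at the point of the disk of radius \<open>2 * r\<close> where \<open>|f|\<close> is largest.\<close>

lemma norm_sym_lift_powr_le_integral_ball:
  fixes p :: real
  assumes p: "p > 0"
  obtains C where "C > 0"
    "\<And>f S z w r. \<lbrakk>f holomorphic_on S; open S; r > 0; cball w (3 * r) \<subseteq> S; z \<in> cball w r\<rbrakk> \<Longrightarrow>
      ennreal (cmod (sym_lift f (z, w)) powr p * r powr (p + 2)) \<le>
        ennreal C * (\<integral>\<^sup>+u. ennreal (cmod (f u) powr p) * indicator (ball w (3 * r)) u \<partial>lborel)"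
proof -
  obtain C where C: "C > 0"
    "\<And>f S z r. \<lbrakk>f holomorphic_on S; open S; r > 0; cball z r \<subseteq> S\<rbrakk> \<Longrightarrow>
      ennreal (cmod (f z) powr p * r\<^sup>2) \<le>
        ennreal C * (\<integral>\<^sup>+u. ennreal (cmod (f u) powr p) * indicator (ball z r) u \<partial>lborel)"
    by (rule norm_powr_le_integral_ball[OF p]) blast
  have "ennreal (cmod (sym_lift f (z, w)) powr p * r powr (p + 2)) \<le>
        ennreal C * (\<integral>\<^sup>+u. ennreal (cmod (f u) powr p) * indicator (ball w (3 * r)) u \<partial>lborel)"
    if f: "f holomorphic_on S" "open S" and r: "r > 0" "cball w (3 * r) \<subseteq> S" and z: "z \<in> cball w r"
    for f S z w r
  proof -
    have sub: "cball w (2 * r) \<subseteq> S" using r by auto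
    have "continuous_on (cball w (2 * r)) (\<lambda>u. cmod (f u))"
      using f(1) sub by (intro continuous_intros holomorphic_on_imp_continuous_on holomorphic_on_subset[OF f(1)])
    from continuous_attains_sup[OF compact_cball _ this] r(1)
    obtain c where c: "c \<in> cball w (2 * r)" "\<And>v. v \<in> cball w (2 * r) \<Longrightarrow> cmod (f v) \<le> cmod (f c)"
      by fastforce
    have bl: "cball c r \<subseteq> cball w (3 * r)" "ball c r \<subseteq> ball w (3 * r)"
      using c(1) by (simp_all add: cball_subset_cball_iff ball_subset_ball_iff dist_commute)
    have "cmod (sym_lift f (z, w)) * r \<le> cmod (f c)"
      using norm_sym_lift_le[OF f r(1) sub z c(2)] r(1) by (simp add: field_simps)
    then have "(cmod (sym_lift f (z, w)) * r) powr p \<le> cmod (f c) powr p"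
      using p r by (intro powr_mono2) auto
    then have "(cmod (sym_lift f (z, w)) * r) powr p * r\<^sup>2 \<le> cmod (f c) powr p * r\<^sup>2"
      by (intro mult_right_mono) auto
    then have "cmod (sym_lift f (z, w)) powr p * r powr (p + 2) \<le> cmod (f c) powr p * r\<^sup>2"
      using r by (simp add: powr_mult powr_add)
    then have "ennreal (cmod (sym_lift f (z, w)) powr p * r powr (p + 2)) \<le> ennreal (cmod (f c) powr p * r\<^sup>2)"
      by (rule ennreal_leI)
    also have "\<dots> \<le> ennreal C * (\<integral>\<^sup>+u. ennreal (cmod (f u) powr p) * indicator (ball c r) u \<partial>lborel)"
      using bl r by (intro C(2)[OF f]) auto
    also have "\<dots> \<le> ennreal C * (\<integral>\<^sup>+u. ennreal (cmod (f u) powr p) * indicator (ball w (3 * r)) u \<partial>lborel)"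
      using bl by (intro mult_left_mono nn_integral_mono) (auto simp: indicator_def)
    finally show ?thesis .
  qed
  with C(1) show ?thesis using that by blast
qed

text \<open>The cut-off at the unit circle makes the integrand a Borel function on the whole plane, although the values
of \<open>f\<close> off the disk are arbitrary.\<close>

definition disk_power :: "real \<Rightarrow> (complex \<Rightarrow> complex) \<Rightarrow> complex \<Rightarrow> ennreal" where
  "disk_power p f u = ennreal (cmod (f u) powr p) * indicator unit_disk u"

lemma bergman_integral_eq: "bergman_integral \<alpha> p f = (\<integral>\<^sup>+u. disk_power p f u \<partial>weighted_area \<alpha>)"
  by (simp add: bergman_integral_def disk_power_def)

lemma disk_power_measurable:
  fixes p :: real
  assumes "f holomorphic_on unit_disk" "p > 0"
  shows "disk_power p f \<in> borel_measurable borel"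
proof -
  have "continuous_on unit_disk (\<lambda>u. cmod (f u) powr p)"
    using assms by (intro continuous_on_powr' continuous_intros holomorphic_on_imp_continuous_on) auto
  then have "(\<lambda>u. indicator unit_disk u *\<^sub>R (cmod (f u) powr p)) \<in> borel_measurable borel"
    by (intro borel_measurable_continuous_on_indicator) auto
  then have "(\<lambda>u. ennreal (indicator unit_disk u *\<^sub>R (cmod (f u) powr p))) \<in> borel_measurable borel"
    by simp
  also have "(\<lambda>u. ennreal (indicator unit_disk u *\<^sub>R (cmod (f u) powr p)))
      = disk_power p f"
    by (auto simp: fun_eq_iff indicator_def disk_power_def)
  finally show ?thesis .
qed

section \<open>Boundedness below the critical exponent\<close>

text \<open>On the disk of radius \<open>(1 - |w|) / 4\<close> the lift is bounded pointwise by a single number \<open>b\<close>, of size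
\<open>(1 - |w|) powr -(p + 2)\<close> times an area integral of \<open>|f|\<^sup>p\<close>. Multiplying by the measure of the disk, of
size \<open>(1 - |w|) powr (\<alpha> + 2)\<close>, and passing from area to weighted area, which costs
\<open>(1 - |w|) powr -\<alpha>\<close>, leaves the factor \<open>(1 - |w|) powr -p\<close>, which the kernel dominates.
The number \<open>b\<close> is integrated in place of the lift.\<close>

lemma sym_lift_near_diagonal:
  fixes \<alpha> p :: real
  assumes \<alpha>: "\<alpha> > -1" and p: "p > 0"
  obtains C where "C \<ge> 0"
    "\<And>f w. \<lbrakk>f holomorphic_on unit_disk; w \<in> unit_disk\<rbrakk> \<Longrightarrow>
      \<exists>b. (\<forall>z \<in> ball w (1 / 4 * (1 - cmod w)). ennreal (cmod (sym_lift f (z, w)) powr p) \<le> b) \<and>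
        b * emeasure (weighted_area \<alpha>) (ball w (1 / 4 * (1 - cmod w))) \<le>
        ennreal C * (\<integral>\<^sup>+u. disk_power p f u *
            ennreal (cmod (1 - cnj u * w) powr (- p)) \<partial>weighted_area \<alpha>)"
proof -
  obtain C where C: "C > 0"
    "\<And>f S z w r. \<lbrakk>f holomorphic_on S; open S; r > 0; cball w (3 * r) \<subseteq> S; z \<in> cball w r\<rbrakk> \<Longrightarrow>
      ennreal (cmod (sym_lift f (z, w)) powr p * r powr (p + 2)) \<le>
        ennreal C * (\<integral>\<^sup>+u. ennreal (cmod (f u) powr p) * indicator (ball w (3 * r)) u \<partial>lborel)"
    by (rule norm_sym_lift_powr_le_integral_ball[OF p]) blast
  define A where "A = pi / (\<alpha> + 1) * 4 powr \<bar>\<alpha>\<bar>"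
  define B where "B = (\<alpha> + 1) / pi * 4 powr \<bar>\<alpha>\<bar>"
  have A: "A > 0" and B: "B > 0" using \<alpha> by (auto simp: A_def B_def)
  let ?C = "C * A * B * pi * 12 powr p"
  have "\<exists>b. (\<forall>z \<in> ball w (1 / 4 * (1 - cmod w)). ennreal (cmod (sym_lift f (z, w)) powr p) \<le> b) \<and>
        b * emeasure (weighted_area \<alpha>) (ball w (1 / 4 * (1 - cmod w))) \<le>
        ennreal ?C * (\<integral>\<^sup>+u. disk_power p f u *
            ennreal (cmod (1 - cnj u * w) powr (- p)) \<partial>weighted_area \<alpha>)"
    if f: "f holomorphic_on unit_disk" and w: "w \<in> unit_disk" for f w
  proof -
    note [measurable] = disk_power_measurable[OF f p]
    define d where "d = 1 - cmod w"
    define r where "r = d / 4"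
    have d: "d > 0" and r: "r > 0" using w by (auto simp: d_def r_def)
    have b3: "ball w (3 * r) = ball w (3 / 4 * (1 - cmod w))" by (simp add: r_def d_def)
    have b1: "ball w (1 / 4 * (1 - cmod w)) = ball w r" by (simp add: r_def d_def)
    have br: "ball w r \<subseteq> ball w (3 * r)" using r by (intro subset_ball) auto
    define J where "J = (\<integral>\<^sup>+u. ennreal (cmod (f u) powr p) * indicator (ball w (3 * r)) u \<partial>lborel)"
    define X where "X = (\<integral>\<^sup>+u. disk_power p f u * ennreal (cmod (1 - cnj u * w) powr (- p)) \<partial>weighted_area \<alpha>)"
    define b where "b = ennreal (r powr (- (p + 2))) * (ennreal C * J)"
    have sub: "cball w (3 * r) \<subseteq> unit_disk"
      using d by (simp add: cball_subset_ball_iff r_def d_def field_simps)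
    have "ennreal (cmod (sym_lift f (z, w)) powr p) \<le> b" if "z \<in> ball w r" for z
    proof -
      have "ennreal (cmod (sym_lift f (z, w)) powr p) =
        ennreal (r powr (- (p + 2))) * ennreal (cmod (sym_lift f (z, w)) powr p * r powr (p + 2))"
        using r by (simp add: ennreal_mult'[symmetric] mult.left_commute flip: powr_add)
      also have "\<dots> \<le> b"
        unfolding b_def J_def using that r sub by (intro mult_left_mono C(2)[OF f]) auto
      finally show ?thesis .
    qed
    moreover have "b * emeasure (weighted_area \<alpha>) (ball w r) \<le> ennreal ?C * X"
    proof -
      have "emeasure (weighted_area \<alpha>) (ball w r) =
          (\<integral>\<^sup>+u. ennreal (bergman_weight \<alpha> u) * indicator (ball w r) u \<partial>lborel)"
        using \<alpha> by (simp add: weighted_area_eq_density emeasure_density)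
      also have "\<dots> \<le> (\<integral>\<^sup>+u. ennreal (B * d powr \<alpha>) * indicator (ball w r) u \<partial>lborel)"
      proof (rule nn_integral_mono)
        fix u show "ennreal (bergman_weight \<alpha> u) * indicator (ball w r) u
            \<le> ennreal (B * d powr \<alpha>) * indicator (ball w r) u"
        proof (cases "u \<in> ball w r")
          case True
          then have "u \<in> ball w (3 / 4 * (1 - cmod w))" using br b3 by auto
          note u = weight_comparable_near[OF w this]
          have "bergman_weight \<alpha> u \<le> (\<alpha> + 1) / pi * (4 powr \<bar>\<alpha>\<bar> * d powr \<alpha>)"
            using u(1) mult_left_mono[OF u(2)[of \<alpha>], of "(\<alpha> + 1) / pi"] \<alpha>
            unfolding bergman_weight_def d_def by simp
          then show ?thesis using True by (simp add: B_def mult_ac ennreal_leI)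
        qed simp
      qed
      also have "\<dots> = ennreal (B * d powr \<alpha>) * emeasure lborel (ball w r)"
        by (rule nn_integral_cmult_indicator) simp
      also have "\<dots> = ennreal (B * d powr \<alpha> * (pi * r\<^sup>2))"
        using B r by (simp add: emeasure_disk ennreal_mult')
      finally have mu: "emeasure (weighted_area \<alpha>) (ball w r) \<le> ennreal (B * d powr \<alpha> * (pi * r\<^sup>2))" .
      have "J \<le> (\<integral>\<^sup>+u. ennreal (A * d powr (- \<alpha>) * (3 * d) powr p) * (ennreal (bergman_weight \<alpha> u) *
          (disk_power p f u * ennreal (cmod (1 - cnj u * w) powr (- p)))) \<partial>lborel)"
        unfolding J_def
      proof (rule nn_integral_mono)
        fix u
        show "ennreal (cmod (f u) powr p) * indicator (ball w (3 * r)) u \<le>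
          ennreal (A * d powr (- \<alpha>) * (3 * d) powr p) * (ennreal (bergman_weight \<alpha> u) *
          (disk_power p f u * ennreal (cmod (1 - cnj u * w) powr (- p))))"
        proof (cases "u \<in> ball w (3 * r)")
          case True
          note u = weight_comparable_near[OF w True[unfolded b3]]
          have ne: "1 - cnj u * w \<noteq> 0"
          proof
            assume "1 - cnj u * w = 0"
            then have "cmod u * cmod w = 1" by (metis norm_mult complex_mod_cnj eq_iff_diff_eq_0 norm_one)
            then show False using u(1) w
              by (metis mult_le_one norm_ge_zero mem_ball_0 less_irrefl mult_strict_mono' mult_1)
          qed
          have "\<alpha> + 1 \<noteq> 0" using \<alpha> by simp
          then have "A * bergman_weight \<alpha> u = 4 powr \<bar>\<alpha>\<bar> * (1 - (cmod u)\<^sup>2) powr \<alpha>"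
            using u(1) by (simp add: A_def bergman_weight_def)
          then have "d powr \<alpha> * d powr (- \<alpha>) \<le> A * bergman_weight \<alpha> u * d powr (- \<alpha>)"
            using u(3)[of \<alpha>] by (intro mult_right_mono) (auto simp: d_def)
          then have 1: "1 \<le> A * d powr (- \<alpha>) * bergman_weight \<alpha> u"
            using d by (simp add: mult_ac flip: powr_add)
          have "1 = (3 * d) powr p * (3 * d) powr (- p)" using d by (simp add: powr_minus)
          also have "\<dots> \<le> (3 * d) powr p * cmod (1 - cnj u * w) powr (- p)"
            using u(4) ne p by (intro mult_left_mono powr_mono2') (auto simp: d_def)
          finally have 2: "1 \<le> (3 * d) powr p * cmod (1 - cnj u * w) powr (- p)" .
          have "1 * 1 \<le> (A * d powr (- \<alpha>) * bergman_weight \<alpha> u) *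
              ((3 * d) powr p * cmod (1 - cnj u * w) powr (- p))"
            using 1 2 by (intro mult_mono) auto
          then have "cmod (f u) powr p * 1 \<le> cmod (f u) powr p * ((A * d powr (- \<alpha>) * bergman_weight \<alpha> u) *
              ((3 * d) powr p * cmod (1 - cnj u * w) powr (- p)))"
            by (intro mult_left_mono) auto
          also have "\<dots> = A * d powr (- \<alpha>) * (3 * d) powr p * (bergman_weight \<alpha> u *
              (cmod (f u) powr p * cmod (1 - cnj u * w) powr (- p)))"
            by (simp only: mult_ac)
          finally show ?thesis
            using True u(1) A \<alpha> by (simp add: ennreal_mult'[symmetric] ennreal_leI bergman_weight_def disk_power_def)
        qed simp
      qed
      also have "\<dots> = ennreal (A * d powr (- \<alpha>) * (3 * d) powr p) * X"
        unfolding X_def using \<alpha> by (subst nn_integral_cmult) (simp_all add: nn_integral_weighted_area)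
      finally have J: "J \<le> ennreal (A * d powr (- \<alpha>) * (3 * d) powr p) * X" .
      have "b * emeasure (weighted_area \<alpha>) (ball w r) \<le>
          ennreal (r powr (- (p + 2))) * (ennreal C * (ennreal (A * d powr (- \<alpha>) * (3 * d) powr p) * X))
          * ennreal (B * d powr \<alpha> * (pi * r\<^sup>2))"
        unfolding b_def by (intro mult_mono mult_left_mono J mu) auto
      also have "\<dots> = ennreal (r powr (- (p + 2)) * C * (A * d powr (- \<alpha>) * (3 * d) powr p)
          * (B * d powr \<alpha> * (pi * r\<^sup>2))) * X"
        using A B C(1) by (simp add: ennreal_mult' mult_ac)
      also have "r powr (- (p + 2)) * C * (A * d powr (- \<alpha>) * (3 * d) powr p)
          * (B * d powr \<alpha> * (pi * r\<^sup>2)) = ?C"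
      proof -
        have "r powr (- (p + 2)) = r powr (- p) / r\<^sup>2"
          using r powr_diff[of r "- p" 2] by simp
        moreover have "(3 * d) powr p = 12 powr p * r powr p"
        proof -
          have "3 * d = 12 * r" by (simp add: r_def)
          then show ?thesis using r by (simp add: powr_mult)
        qed
        ultimately show ?thesis using r d by (simp add: powr_minus field_simps)
      qed
      finally show ?thesis .
    qed
    ultimately show ?thesis unfolding b1 X_def by blast
  qed
  moreover have "?C \<ge> 0" using A B C(1) by simp
  ultimately show ?thesis using that by blast
qed

text \<open>The pointwise bound \<open>b\<close> covers the disk about \<open>w\<close>; outside it \<open>k z w \<le> 9 * |z - w|\<close> and
\<open>|f z - f w| \<le> 2 * max |f z| |f w|\<close>, whence the constant \<open>18 powr p\<close>.\<close>

lemma sym_lift_slice_bound: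
  fixes \<alpha> p :: real
  assumes \<alpha>: "\<alpha> > -1" and p: "p > 0"
  obtains C where "C \<ge> 0"
    "\<And>f w. \<lbrakk>f holomorphic_on unit_disk; w \<in> unit_disk\<rbrakk> \<Longrightarrow>
      (\<integral>\<^sup>+z\<in>unit_disk. ennreal (cmod (sym_lift f (z, w)) powr p) \<partial>weighted_area \<alpha>) \<le>
        ennreal C * (\<integral>\<^sup>+u. (disk_power p f u + disk_power p f w) *
            ennreal (cmod (1 - cnj u * w) powr (- p)) \<partial>weighted_area \<alpha>)"
proof -
  obtain C where C: "C \<ge> 0"
    "\<And>f w. \<lbrakk>f holomorphic_on unit_disk; w \<in> unit_disk\<rbrakk> \<Longrightarrow>
      \<exists>b. (\<forall>z \<in> ball w (1 / 4 * (1 - cmod w)). ennreal (cmod (sym_lift f (z, w)) powr p) \<le> b) \<and>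
        b * emeasure (weighted_area \<alpha>) (ball w (1 / 4 * (1 - cmod w))) \<le>
        ennreal C * (\<integral>\<^sup>+u. disk_power p f u *
            ennreal (cmod (1 - cnj u * w) powr (- p)) \<partial>weighted_area \<alpha>)"
    by (rule sym_lift_near_diagonal[OF \<alpha> p]) blast
  have "(\<integral>\<^sup>+z\<in>unit_disk. ennreal (cmod (sym_lift f (z, w)) powr p) \<partial>weighted_area \<alpha>) \<le>
        ennreal (C + 18 powr p) * (\<integral>\<^sup>+u. (disk_power p f u + disk_power p f w) *
            ennreal (cmod (1 - cnj u * w) powr (- p)) \<partial>weighted_area \<alpha>)"
    if f: "f holomorphic_on unit_disk" and w: "w \<in> unit_disk" for f w
  proof -
    note [measurable] = disk_power_measurable[OF f p]
    define N where "N = ball w (1 / 4 * (1 - cmod w))"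
    have [measurable]: "N \<in> sets borel" by (simp add: N_def)
    have wN: "w \<in> N" using w by (simp add: N_def)
    let ?k = "\<lambda>u. ennreal (cmod (1 - cnj u * w) powr (- p))"
    define Y where "Y = (\<integral>\<^sup>+u. (disk_power p f u + disk_power p f w) * ?k u \<partial>weighted_area \<alpha>)"
    obtain b where b: "\<And>z. z \<in> N \<Longrightarrow> ennreal (cmod (sym_lift f (z, w)) powr p) \<le> b"
      "b * emeasure (weighted_area \<alpha>) N \<le> ennreal C * (\<integral>\<^sup>+u. disk_power p f u * ?k u \<partial>weighted_area \<alpha>)"
      using C(2)[OF f w] unfolding N_def by blast
    have pt: "ennreal (cmod (sym_lift f (z, w)) powr p) * indicator unit_disk z
        \<le> b * indicator N z + ennreal (18 powr p) * ((disk_power p f z + disk_power p f w) * ?k z)" for z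
    proof (cases "z \<in> unit_disk \<and> z \<notin> N")
      case True
      then have zw: "z \<noteq> w" using wN by auto
      define k where "k = cmod (1 - cnj z * w)"
      have k: "k \<le> 9 * cmod (z - w)"
        using norm_one_minus_cnj_mult_le_dist[OF w, of z] True by (simp add: k_def N_def)
      have "cmod (z - w) \<le> cmod (1 - cnj w * z)"
        using dist_le_norm_one_minus_cnj_mult[of w z] w True by auto
      also have "\<dots> = cmod (cnj (1 - cnj w * z))" by (simp only: complex_mod_cnj)
      also have "\<dots> = k" by (simp add: k_def mult.commute)
      finally have k0: "k > 0" using zw by (smt (verit) zero_less_norm_iff right_minus_eq)
      define m where "m = max (cmod (f z)) (cmod (f w))"
      have m: "m \<ge> 0" by (simp add: m_def le_max_iff_disj)
      have "cmod (f z - f w) \<le> 2 * m"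
        using norm_triangle_ineq4[of "f z" "f w"] by (simp add: m_def)
      then have "cmod (sym_lift f (z, w)) \<le> 2 * m / cmod (z - w)"
        using zw by (simp add: sym_lift_def norm_divide divide_right_mono)
      also have "\<dots> \<le> 2 * m / (k / 9)"
        using k k0 m zw by (intro divide_left_mono mult_pos_pos) auto
      finally have "cmod (sym_lift f (z, w)) \<le> 18 * m / k" by simp
      then have "cmod (sym_lift f (z, w)) powr p \<le> (18 * m / k) powr p"
        using p by (intro powr_mono2) auto
      also have "\<dots> = 18 powr p * (m powr p * k powr (- p))"
        using m k0 by (simp add: powr_mult powr_divide powr_minus field_simps)
      also have "\<dots> \<le> 18 powr p * ((cmod (f z) powr p + cmod (f w) powr p) * k powr (- p))"
        by (intro mult_left_mono mult_right_mono) (auto simp: m_def max_def)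
      finally have "ennreal (cmod (sym_lift f (z, w)) powr p)
          \<le> ennreal (18 powr p * ((cmod (f z) powr p + cmod (f w) powr p) * k powr (- p)))"
        by (rule ennreal_leI)
      also have "\<dots> = ennreal (18 powr p) * ((disk_power p f z + disk_power p f w) * ?k z)"
        using True w by (simp add: disk_power_def ennreal_mult' k_def)
      finally show ?thesis using True by simp
    next
      case False
      then show ?thesis using b(1)[of z]
        by (cases "z \<in> N") (auto simp: indicator_def intro: add_increasing2)
    qed
    have "(\<integral>\<^sup>+z\<in>unit_disk. ennreal (cmod (sym_lift f (z, w)) powr p) \<partial>weighted_area \<alpha>)
        \<le> (\<integral>\<^sup>+z. b * indicator N z + ennreal (18 powr p) * ((disk_power p f z + disk_power p f w) * ?k z) \<partial>weighted_area \<alpha>)"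
      by (intro nn_integral_mono pt)
    also have "\<dots> = b * emeasure (weighted_area \<alpha>) N + ennreal (18 powr p) * Y"
      unfolding Y_def by (simp add: nn_integral_add nn_integral_cmult nn_integral_cmult_indicator)
    also have "\<dots> \<le> ennreal C * Y + ennreal (18 powr p) * Y"
    proof (rule add_right_mono)
      have "(\<integral>\<^sup>+u. disk_power p f u * ?k u \<partial>weighted_area \<alpha>) \<le> Y"
        unfolding Y_def by (intro nn_integral_mono mult_right_mono) auto
      then show "b * emeasure (weighted_area \<alpha>) N \<le> ennreal C * Y"
        using b(2) by (meson mult_left_mono order_trans zero_le)
    qed
    also have "\<dots> = ennreal (C + 18 powr p) * Y"
      using C(1) by (simp add: ennreal_plus distrib_right)
    finally show ?thesis unfolding Y_def .
  qed
  moreover have "C + 18 powr p \<ge> 0" using C(1) by simp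
  ultimately show ?thesis using that by blast
qed

text \<open>Integrating the slice bound over \<open>w\<close> gives two double integrals, with \<open>|f u|\<^sup>p\<close> and with \<open>|f w|\<^sup>p\<close>.
They are equal by Tonelli's theorem and the symmetry of the kernel, and in the second one the
Forelli--Rudin estimate applies to the inner integral.\<close>

lemma sym_lift_maps_boundedly_of_less:
  assumes \<alpha>: "\<alpha> > -1" and p: "0 < p" "p < \<alpha> + 2"
  shows "sym_lift_maps_boundedly \<alpha> p"
proof -
  interpret finite_measure "weighted_area \<alpha>" by (rule finite_measure_weighted_area[OF \<alpha>])
  interpret pair: pair_sigma_finite "weighted_area \<alpha>" "weighted_area \<alpha>" ..
  obtain F where F: "F \<ge> 0" "\<And>u. u \<in> unit_disk \<Longrightarrow>
    (\<integral>\<^sup>+w. ennreal (cmod (1 - cnj u * w) powr (- p)) \<partial>weighted_area \<alpha>) \<le> ennreal F"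
    using forelli_rudin[OF assms] by blast
  obtain C where C: "C \<ge> 0"
    "\<And>f w. \<lbrakk>f holomorphic_on unit_disk; w \<in> unit_disk\<rbrakk> \<Longrightarrow>
      (\<integral>\<^sup>+z\<in>unit_disk. ennreal (cmod (sym_lift f (z, w)) powr p) \<partial>weighted_area \<alpha>) \<le>
        ennreal C * (\<integral>\<^sup>+u. (disk_power p f u + disk_power p f w) *
            ennreal (cmod (1 - cnj u * w) powr (- p)) \<partial>weighted_area \<alpha>)"
    by (rule sym_lift_slice_bound[OF \<alpha> p(1)]) blast
  \<comment> \<open>The summand \<open>1\<close> only makes the constant strictly positive.\<close>
  have "bergman_integral2 \<alpha> p (sym_lift f) \<le> ennreal (2 * C * F + 1) * bergman_integral \<alpha> p f"
    if f: "f holomorphic_on unit_disk" for f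
  proof -
    note [measurable] = disk_power_measurable[OF f p(1)]
    let ?k = "\<lambda>u w. ennreal (cmod (1 - cnj u * w) powr (- p))"
    let ?h = "disk_power p f"
    have sym: "?k u w = ?k w u" for u w
    proof -
      have "cnj (1 - cnj u * w) = 1 - cnj w * u" by (simp add: mult.commute)
      then show ?thesis by (metis complex_mod_cnj)
    qed
    have hk: "?h u * (\<integral>\<^sup>+w. ?k u w \<partial>weighted_area \<alpha>) \<le> ?h u * ennreal F" for u
      using F(2)[of u] by (cases "u \<in> unit_disk") (auto simp: disk_power_def intro!: mult_left_mono)
    have S: "(\<integral>\<^sup>+w. (\<integral>\<^sup>+u. ?h w * ?k u w \<partial>weighted_area \<alpha>) \<partial>weighted_area \<alpha>)
        \<le> ennreal F * bergman_integral \<alpha> p f"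
    proof -
      have "(\<integral>\<^sup>+u. ?h w * ?k u w \<partial>weighted_area \<alpha>) \<le> ennreal F * ?h w" for w
        using hk[of w] unfolding sym[of _ w] by (simp add: nn_integral_cmult mult.commute)
      then have "(\<integral>\<^sup>+w. (\<integral>\<^sup>+u. ?h w * ?k u w \<partial>weighted_area \<alpha>) \<partial>weighted_area \<alpha>)
          \<le> (\<integral>\<^sup>+w. ennreal F * ?h w \<partial>weighted_area \<alpha>)"
        by (rule nn_integral_mono)
      then show ?thesis by (simp add: nn_integral_cmult bergman_integral_eq)
    qed
    have "(\<integral>\<^sup>+w. (\<integral>\<^sup>+u. ?h u * ?k u w \<partial>weighted_area \<alpha>) \<partial>weighted_area \<alpha>)
        = (\<integral>\<^sup>+u. (\<integral>\<^sup>+w. ?h u * ?k u w \<partial>weighted_area \<alpha>) \<partial>weighted_area \<alpha>)"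
      by (rule pair.Fubini'[symmetric]) measurable
    also have "\<dots> = (\<integral>\<^sup>+w. (\<integral>\<^sup>+u. ?h w * ?k u w \<partial>weighted_area \<alpha>) \<partial>weighted_area \<alpha>)"
      by (intro nn_integral_cong) (metis sym)
    finally have S': "(\<integral>\<^sup>+w. (\<integral>\<^sup>+u. ?h u * ?k u w \<partial>weighted_area \<alpha>) \<partial>weighted_area \<alpha>)
        \<le> ennreal F * bergman_integral \<alpha> p f"
      using S by simp
    have "bergman_integral2 \<alpha> p (sym_lift f)
        \<le> (\<integral>\<^sup>+w. ennreal C * (\<integral>\<^sup>+u. (?h u + ?h w) * ?k u w \<partial>weighted_area \<alpha>) \<partial>weighted_area \<alpha>)"
      unfolding bergman_integral2_def
      by (intro nn_integral_mono) (use C(2)[OF f] in \<open>auto simp: indicator_def\<close>)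
    also have "\<dots> = (\<integral>\<^sup>+w. ennreal C * ((\<integral>\<^sup>+u. ?h u * ?k u w \<partial>weighted_area \<alpha>)
        + (\<integral>\<^sup>+u. ?h w * ?k u w \<partial>weighted_area \<alpha>)) \<partial>weighted_area \<alpha>)"
      by (simp add: distrib_right nn_integral_add)
    also have "\<dots> = ennreal C * ((\<integral>\<^sup>+w. (\<integral>\<^sup>+u. ?h u * ?k u w \<partial>weighted_area \<alpha>) \<partial>weighted_area \<alpha>)
        + (\<integral>\<^sup>+w. (\<integral>\<^sup>+u. ?h w * ?k u w \<partial>weighted_area \<alpha>) \<partial>weighted_area \<alpha>))"
      by (simp add: nn_integral_cmult nn_integral_add)
    also have "\<dots> \<le> ennreal C * (ennreal F * bergman_integral \<alpha> p f + ennreal F * bergman_integral \<alpha> p f)"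
      by (intro mult_left_mono add_mono S S') auto
    also have "\<dots> = ennreal (2 * C * F) * bergman_integral \<alpha> p f"
      using C(1) F(1) by (simp add: ennreal_mult' mult_ac flip: distrib_left mult_2)
    also have "\<dots> \<le> ennreal (2 * C * F + 1) * bergman_integral \<alpha> p f"
      by (intro mult_right_mono ennreal_leI) auto
    finally show ?thesis .
  qed
  moreover have "2 * C * F + 1 > 0" using C(1) F(1) by (simp add: add_nonneg_pos)
  ultimately show ?thesis
    unfolding sym_lift_maps_boundedly_def bergman_space_def by blast
qed

section \<open>Unboundedness above the critical exponent\<close>

lemma sym_lift_cauchy_kernel:
  fixes r :: real
  assumes "0 < r" "r < 1" "z \<in> unit_disk" "w \<in> unit_disk"
  defines "f \<equiv> (\<lambda>z::complex. 1 / (1 - of_real r * z))"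
  shows "sym_lift f (z, w) = of_real r * f z * f w"
proof -
  have ne: "1 - of_real r * z \<noteq> 0" if "z \<in> unit_disk" for z :: complex
  proof
    assume "1 - of_real r * z = 0"
    then have "cmod (of_real r * z) = 1" by simp
    moreover have "cmod (of_real r * z) < 1"
      using assms(1,2) that by (simp add: norm_mult mult_le_one mult_strict_mono'[of r 1 "cmod z" 1, simplified])
    ultimately show False by simp
  qed
  show ?thesis
  proof (cases "z = w")
    case True
    have "(f has_field_derivative of_real r / (1 - of_real r * z)\<^sup>2) (at z)"
      unfolding f_def using ne[OF assms(3)]
      by (auto intro!: derivative_eq_intros simp: power2_eq_square)
    then have "deriv f z = of_real r / (1 - of_real r * z)\<^sup>2" by (rule DERIV_imp_deriv)
    then show ?thesis using True by (simp add: sym_lift_def f_def power2_eq_square)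
  next
    case False
    then show ?thesis
      using ne[OF assms(3)] ne[OF assms(4)]
      by (simp add: sym_lift_def f_def divide_simps) (simp add: algebra_simps)
  qed
qed


text \<open>Only the disk of radius \<open>(1 - r) / 4\<close> about \<open>r\<close> is needed: there \<open>|1 - r * z| \<le> 3 * (1 - r)\<close>, the weight
is at least a multiple of \<open>(1 - r) powr \<alpha>\<close>, and the area is a multiple of \<open>(1 - r)\<^sup>2\<close>.\<close>

lemma cauchy_kernel_integral_ge:
  fixes \<alpha> p r :: real
  assumes \<alpha>: "\<alpha> > -1" and p: "p > 0" and r: "0 < r" "r < 1"
  shows "ennreal ((\<alpha> + 1) / (4 powr \<bar>\<alpha>\<bar> * 3 powr p * 16) * (1 - r) powr (\<alpha> + 2 - p))
    \<le> bergman_integral \<alpha> p (\<lambda>z. 1 / (1 - of_real r * z))"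
proof -
  define c :: complex where "c = of_real r"
  define d where "d = 1 - r"
  have c: "c \<in> unit_disk" and d: "1 - cmod c = d" "d > 0" and cc: "cnj c = c"
    using r by (auto simp: c_def d_def)
  let ?f = "\<lambda>z. 1 / (1 - of_real r * z)"
  let ?N = "ball c (d / 4)"
  define m where "m = (\<alpha> + 1) / pi * (d powr \<alpha> / 4 powr \<bar>\<alpha>\<bar>) * (3 * d) powr (- p)"
  have m0: "m \<ge> 0" using \<alpha> by (simp add: m_def)
  have "m * (pi * (d / 4)\<^sup>2) = (\<alpha> + 1) / (4 powr \<bar>\<alpha>\<bar> * 3 powr p * 16) * d powr (\<alpha> + 2 - p)"
    using d by (simp add: m_def powr_mult powr_minus powr_add powr_diff power2_eq_square field_simps)
  then have "ennreal ((\<alpha> + 1) / (4 powr \<bar>\<alpha>\<bar> * 3 powr p * 16) * d powr (\<alpha> + 2 - p))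
      = ennreal m * emeasure lborel ?N"
    using d m0 by (simp add: emeasure_disk flip: ennreal_mult')
  also have "\<dots> = (\<integral>\<^sup>+z. ennreal m * indicator ?N z \<partial>lborel)"
    by (rule nn_integral_cmult_indicator[symmetric]) simp
  also have "\<dots> \<le> (\<integral>\<^sup>+z. ennreal (bergman_weight \<alpha> z) * disk_power p ?f z \<partial>lborel)"
  proof (rule nn_integral_mono)
    fix z
    show "ennreal m * indicator ?N z \<le> ennreal (bergman_weight \<alpha> z) * disk_power p ?f z"
    proof (cases "z \<in> ?N")
      case True
      then have z: "z \<in> ball c (3 / 4 * (1 - cmod c))" using d by auto
      note zc = weight_comparable_near[OF c z]
      have k: "cmod (1 - cnj z * c) = cmod (1 - c * z)"
        by (metis cc complex_cnj_diff complex_cnj_mult complex_cnj_one complex_mod_cnj complex_cnj_cnj mult.commute)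
      have k0: "cmod (1 - c * z) > 0"
      proof -
        have "0 < 1 - (cmod c)\<^sup>2" using c by (simp add: power_less_one_iff abs_square_less_1)
        also have "\<dots> \<le> 2 * cmod (1 - cnj z * c)"
          using one_minus_norm_sq_le[of z c] zc(1) c by simp
        finally show ?thesis using k by simp
      qed
      have "d powr \<alpha> / 4 powr \<bar>\<alpha>\<bar> \<le> (1 - (cmod z)\<^sup>2) powr \<alpha>"
        using zc(3)[of \<alpha>] d by (simp add: field_simps)
      then have "m \<le> (\<alpha> + 1) / pi * (1 - (cmod z)\<^sup>2) powr \<alpha> * cmod (1 - c * z) powr (- p)"
        unfolding m_def using zc(4) \<alpha> p k k0 d
        by (intro mult_mono mult_left_mono powr_mono2') auto
      also have "cmod (1 - c * z) powr (- p) = cmod (?f z) powr p"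
        by (simp add: c_def norm_divide powr_divide powr_minus field_simps)
      finally have "m \<le> bergman_weight \<alpha> z * cmod (?f z) powr p"
        using zc(1) by (simp add: bergman_weight_def)
      then show ?thesis
        using True zc(1) \<alpha> by (simp add: disk_power_def ennreal_leI bergman_weight_def flip: ennreal_mult')
    qed simp
  qed
  also have "\<dots> = bergman_integral \<alpha> p ?f"
    using \<alpha> unfolding bergman_integral_eq
    by (subst nn_integral_weighted_area) (auto simp: disk_power_def[abs_def])
  finally show ?thesis by (simp add: d_def)
qed

lemma cauchy_kernel_in_bergman_space:
  fixes \<alpha> p r :: real
  assumes \<alpha>: "\<alpha> > -1" and p: "p > 0" and r: "0 < r" "r < 1"
  shows "(\<lambda>z. 1 / (1 - of_real r * z)) \<in> bergman_space \<alpha> p"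
proof -
  interpret finite_measure "weighted_area \<alpha>" by (rule finite_measure_weighted_area[OF \<alpha>])
  let ?f = "\<lambda>z. 1 / (1 - of_real r * z) :: complex"
  have low: "1 - r \<le> cmod (1 - of_real r * z)" if "z \<in> unit_disk" for z
  proof -
    have "cmod (of_real r * z) \<le> r * 1"
      unfolding norm_mult using that r by (intro mult_mono) auto
    then show ?thesis using norm_triangle_ineq2[of 1 "of_real r * z"] by simp
  qed
  have "?f holomorphic_on unit_disk"
    using low r by (intro holomorphic_intros) fastforce
  moreover have "bergman_integral \<alpha> p ?f \<le> (\<integral>\<^sup>+z. ennreal ((1 / (1 - r)) powr p) \<partial>weighted_area \<alpha>)"
    unfolding bergman_integral_def
  proof (rule nn_integral_mono)
    fix z
    have "cmod (?f z) powr p \<le> (1 / (1 - r)) powr p" if "z \<in> unit_disk"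
      using low[OF that] r p by (intro powr_mono2) (auto simp: norm_divide intro!: divide_left_mono mult_pos_pos)
    then show "ennreal (cmod (?f z) powr p) * indicator unit_disk z \<le> ennreal ((1 / (1 - r)) powr p)"
      by (auto simp: indicator_def ennreal_leI)
  qed
  moreover have "\<dots> < \<infinity>"
    by (simp add: ennreal_mult_eq_top_iff less_top[symmetric])
  ultimately show ?thesis by (simp add: bergman_space_def)
qed

lemma bergman_integral2_sym_lift_cauchy_kernel:
  fixes \<alpha> p r :: real
  assumes r: "0 < r" "r < 1"
  defines "f \<equiv> (\<lambda>z. 1 / (1 - of_real r * z))"
  shows "bergman_integral2 \<alpha> p (sym_lift f) = ennreal (r powr p) * (bergman_integral \<alpha> p f * bergman_integral \<alpha> p f)"
proof -
  have [measurable]: "f \<in> borel_measurable borel" unfolding f_def by simp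
  have [measurable]: "disk_power p f \<in> borel_measurable borel" unfolding disk_power_def[abs_def] by simp
  have "bergman_integral2 \<alpha> p (sym_lift f) =
    (\<integral>\<^sup>+w. (\<integral>\<^sup>+z. ennreal (r powr p) * disk_power p f w * disk_power p f z \<partial>weighted_area \<alpha>) \<partial>weighted_area \<alpha>)"
    unfolding bergman_integral2_def
  proof (rule nn_integral_cong)
    fix w
    show "(\<integral>\<^sup>+z\<in>unit_disk. ennreal (cmod (sym_lift f (z, w)) powr p) \<partial>weighted_area \<alpha>) * indicator unit_disk w
      = (\<integral>\<^sup>+z. ennreal (r powr p) * disk_power p f w * disk_power p f z \<partial>weighted_area \<alpha>)"
    proof (cases "w \<in> unit_disk")
      case True
      have "ennreal (cmod (sym_lift f (z, w)) powr p) * indicator unit_disk z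
          = ennreal (r powr p) * disk_power p f w * disk_power p f z" for z
      proof (cases "z \<in> unit_disk")
        case z: True
        have "sym_lift f (z, w) = of_real r * f z * f w"
          unfolding f_def by (rule sym_lift_cauchy_kernel[OF r z True])
        then show ?thesis
          using True z r by (simp add: disk_power_def norm_mult powr_mult ennreal_mult' mult_ac)
      qed (simp add: disk_power_def)
      then show ?thesis using True by simp
    qed (simp add: disk_power_def)
  qed
  also have "\<dots> = ennreal (r powr p) * (bergman_integral \<alpha> p f * bergman_integral \<alpha> p f)"
    by (simp add: nn_integral_cmult nn_integral_multc bergman_integral_eq mult.assoc)
  finally show ?thesis .
qed

lemma not_sym_lift_maps_boundedly_of_greater:
  assumes \<alpha>: "\<alpha> > -1" and p: "p > \<alpha> + 2"
  shows "\<not> sym_lift_maps_boundedly \<alpha> p"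
proof
  assume "sym_lift_maps_boundedly \<alpha> p"
  then obtain C where C: "C > 0" "\<And>f. f \<in> bergman_space \<alpha> p \<Longrightarrow>
      bergman_integral2 \<alpha> p (sym_lift f) \<le> ennreal C * bergman_integral \<alpha> p f"
    unfolding sym_lift_maps_boundedly_def by blast
  have p0: "p > 0" using \<alpha> p by simp
  define q where "q = p - \<alpha> - 2"
  have q: "q > 0" using p by (simp add: q_def)
  define a where "a = (\<alpha> + 1) / (4 powr \<bar>\<alpha>\<bar> * 3 powr p * 16)"
  have a: "a > 0" using \<alpha> by (simp add: a_def)
  have key: "r powr p * (a * (1 - r) powr (- q)) \<le> C" if r: "0 < r" "r < 1" for r
  proof -
    define f :: "complex \<Rightarrow> complex" where "f = (\<lambda>z. 1 / (1 - of_real r * z))"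
    have f: "f \<in> bergman_space \<alpha> p"
      unfolding f_def by (rule cauchy_kernel_in_bergman_space[OF \<alpha> p0 r])
    then obtain I where I: "bergman_integral \<alpha> p f = ennreal I" "I \<ge> 0"
      by (cases "bergman_integral \<alpha> p f") (auto simp: bergman_space_def)
    have "ennreal (a * (1 - r) powr (- q)) \<le> ennreal I"
      using cauchy_kernel_integral_ge[OF \<alpha> p0 r] I by (simp add: f_def a_def q_def algebra_simps)
    then have aI: "a * (1 - r) powr (- q) \<le> I" using I by simp
    moreover have "a * (1 - r) powr (- q) > 0" using a r by simp
    ultimately have I0: "I > 0" by linarith
    have "ennreal (r powr p * (I * I)) \<le> ennreal (C * I)"
      using C(2)[OF f] bergman_integral2_sym_lift_cauchy_kernel[OF r, of \<alpha> p] I C(1)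
      by (simp add: ennreal_mult' flip: f_def)
    then have "r powr p * I \<le> C"
      using I0 C(1) by (simp flip: mult.assoc)
    moreover have "r powr p * (a * (1 - r) powr (- q)) \<le> r powr p * I"
      using aI by (intro mult_left_mono) auto
    ultimately show ?thesis by linarith
  qed
  have "filterlim (\<lambda>r. r powr p * (a * (1 - r) powr (- q))) at_top (at_left 1)"
    using a q p0 by real_asymp
  then have "eventually (\<lambda>r. r powr p * (a * (1 - r) powr (- q)) > C) (at_left 1)"
    by (simp add: filterlim_at_top_dense)
  moreover have "eventually (\<lambda>r. r \<in> {0<..<1}) (at_left (1::real))"
    by (rule eventually_at_left_real) simp
  ultimately have "eventually (\<lambda>r::real. False) (at_left 1)"
    by eventually_elim (use key in force)
  then show False by simp
qed

theorem theorem11: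
  fixes \<alpha> p :: real
  assumes "\<alpha> > -1"
  shows "(0 < p \<and> p < \<alpha> + 2 \<longrightarrow> sym_lift_maps_boundedly \<alpha> p) \<and>
         (p > \<alpha> + 2 \<longrightarrow> \<not> sym_lift_maps_boundedly \<alpha> p)"
  using sym_lift_maps_boundedly_of_less[OF assms] not_sym_lift_maps_boundedly_of_greater[OF assms]
  by blast

end
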